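(* Let $G$ be a 2-edge-connected graph with vertex set $V(G)=\{P_1,\ldots,P_n\}$ (with $n=|V(G)|$), and let $D=P_1+\cdots+P_n\in \mathrm{Div}(G)$. Then the following conditions are equivalent: (1) $G$ is the complete graph $K_n$; (2) $r(D)=2$, and there exist $i,j$ with $i\neq j$ such that the vertices $P_i$ and $P_j$ are Galois points with respect to $|D|$. Moreover, in this case, all vertices $P_1,\ldots,P_n\in V(G)$ are Galois points with respect to $|D|$.
   Context: All graphs are finite, undirected, connected and simple (no loops or multiple edges), except that quotient graphs defined below may have parallel edges. A graph is 2-edge-connected if it has at least two vertices, is connected, and stays connected after deleting any single edge. Divisors. $\mathrm{Div}(G)$ is the free abelian group on $V(G)$. For $D=\sum_P a_P P$ put $D(P)=a_P$, $\deg(D)=\sum_P a_P$; $D$ is effective ($D\ge 0$) if all $a_P\ge 0$. For $f:V(G)\to\mathbb{Z}$ let $\Delta(f)=\sum_{P\in V(G)}\sum_{\overline{PQ}\in E(G)}(f(P)-f(Q))P$, the inner sum being over edges $\overline{PQ}$ at $P$. Divisors $D,D'$ are linearly equivalent, $D\sim D'$, if $D-D'=\Delta(f)$ for some $f:V(G)\to\mathbb{Z}$. The linear system of $D$ is $|D|=\{E\in\mathrm{Div}(G): E\ge 0,\ E\sim D\}$. The rank $r(D)$ is $-1$ if $|D|=\emptyset$; otherwise it is the largest integer $s\ge 0$ such that $|D-E|\neq\emptyset$ for every effective divisor $E$ of degree $s$. Harmonic actions. $\mathrm{Aut}(G)$ is the automorphism group of $G$; it acts on $\mathrm{Div}(G)$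 by $\sigma(\sum a_P P)=\sum a_P\,\sigma(P)$. For a subgroup $\Gamma\subset\mathrm{Aut}(G)$, the quotient graph $G/\Gamma$ has vertex set the set of $\Gamma$-orbits of vertices and edge set the set of $\Gamma$-orbits $\Gamma e$ of those edges $e$ whose two endpoints lie in different $\Gamma$-orbits (the endpoints of $\Gamma e$ are the orbits of the endpoints of $e$). The quotient map $\phi_\Gamma:G\to G/\Gamma$ sends a vertex $P$ to $\Gamma P$, an edge $e$ with endpoints in different orbits to $\Gamma e$, and an edge with both endpoints in the same orbit to that orbit (a vertex of $G/\Gamma$). The map $\phi_\Gamma$ is harmonic if for every $P\in V(G)$ the number $|\{e\in E(G): P\in e,\ \phi_\Gamma(e)=e'\}|$ is the same for all edges $e'$ of $G/\Gamma$ having $\phi_\Gamma(P)$ as an endpoint. The group $\Gamma$ acts harmonically on $G$ if for every subgroup $\Lambda\subset\Gamma$ the quotient map $\phi_\Lambda:G\to G/\Lambda$ is harmonic. Galois points. Let $G$ be 2-edge-connected and let $D$ be a divisor with $r(D)=2$. A vertex $P\in V(G)$ is a Galois point with respect to $|D|$ if: (1) $r(D-P)=1$; (2) for every $Q\in V(G)$ (including $Q=P$), $r(D-P-Q)=0$; (3) there exist a subgroup $H\subset\mathrm{Aut}(G)$ with $|H|=\deg(D)-1$ and distinct effective divisors $E_1,E_2\in|D-P|$ such that (i) $|V(G/H)|>1$, (ii) $H$ acts harmonically on $G$, and (iii) $\sigma(E_1)=E_1$ and $\sigma(E_2)=E_2$ for every $\sigma\in H$. *)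

theory Defs
  imports "HOL-Algebra.Algebra"
begin

section \<open>Finite simple graphs\<close>

text \<open>A graph is given by its vertex set and its set of edges, an edge being the
  two-element set of its endpoints. Connectedness is not part of \<open>simple_graph\<close>; it is
  part of \<open>two_edge_connected\<close>.\<close>

definition simple_graph :: "'a set \<Rightarrow> 'a set set \<Rightarrow> bool" where
  "simple_graph V E \<longleftrightarrow> finite V \<and> (\<forall>e\<in>E. e \<subseteq> V \<and> card e = 2)"

definition connected_graph :: "'a set \<Rightarrow> 'a set set \<Rightarrow> bool" where
  "connected_graph V E \<longleftrightarrow>
     V \<noteq> {} \<and> (\<forall>x\<in>V. \<forall>y\<in>V. (x, y) \<in> {(u, v). {u, v} \<in> E}\<^sup>*)"

definition two_edge_connected :: "'a set \<Rightarrow> 'a set set \<Rightarrow> bool" where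
  "two_edge_connected V E \<longleftrightarrow>
     2 \<le> card V \<and> connected_graph V E \<and> (\<forall>e\<in>E. connected_graph V (E - {e}))"

definition complete_graph :: "'a set \<Rightarrow> 'a set set \<Rightarrow> bool" where
  "complete_graph V E \<longleftrightarrow> E = {e. e \<subseteq> V \<and> card e = 2}"


section \<open>Divisors\<close>

text \<open>\<open>Div(G)\<close> is the carrier of the library's free abelian group on \<open>V\<close>; the vertex \<open>P\<close>
  viewed as a divisor is \<open>frag_of P\<close>, and \<open>D(P)\<close> is \<open>Poly_Mapping.lookup D P\<close>.\<close>

abbreviation Divs :: "'a set \<Rightarrow> ('a \<Rightarrow>\<^sub>0 int) set" where
  "Divs V \<equiv> carrier (free_Abelian_group V)"

definition div_deg :: "'a set \<Rightarrow> ('a \<Rightarrow>\<^sub>0 int) \<Rightarrow> int" where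
  "div_deg V D = (\<Sum>P\<in>V. Poly_Mapping.lookup D P)"

definition effective :: "('a \<Rightarrow>\<^sub>0 int) \<Rightarrow> bool" where
  "effective D \<longleftrightarrow> (\<forall>P. 0 \<le> Poly_Mapping.lookup D P)"

definition laplacian :: "'a set \<Rightarrow> 'a set set \<Rightarrow> ('a \<Rightarrow> int) \<Rightarrow> ('a \<Rightarrow>\<^sub>0 int)" where
  "laplacian V E f =
     (\<Sum>P\<in>V. frag_cmul (\<Sum>Q\<in>{Q. {P, Q} \<in> E}. f P - f Q) (frag_of P))"

definition lin_equiv :: "'a set \<Rightarrow> 'a set set \<Rightarrow> ('a \<Rightarrow>\<^sub>0 int) \<Rightarrow> ('a \<Rightarrow>\<^sub>0 int) \<Rightarrow> bool" where
  "lin_equiv V E D D' \<longleftrightarrow> (\<exists>f. D - D' = laplacian V E f)"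

definition linear_system :: "'a set \<Rightarrow> 'a set set \<Rightarrow> ('a \<Rightarrow>\<^sub>0 int) \<Rightarrow> ('a \<Rightarrow>\<^sub>0 int) set" where
  "linear_system V E D = {F \<in> Divs V. effective F \<and> lin_equiv V E F D}"

definition div_rank :: "'a set \<Rightarrow> 'a set set \<Rightarrow> ('a \<Rightarrow>\<^sub>0 int) \<Rightarrow> int" where
  "div_rank V E D =
     (if linear_system V E D = {} then -1
      else int (GREATEST s. \<forall>F\<in>Divs V.
             effective F \<and> div_deg V F = int s \<longrightarrow> linear_system V E (D - F) \<noteq> {}))"


section \<open>Automorphisms and harmonic actions\<close>

text \<open>Automorphisms are extensional functions on \<open>V\<close> (as in \<^const>\<open>BijGroup\<close>), so that
  distinct group elements are distinct automorphisms and cardinalities are as expected.\<close>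

definition graph_auto :: "'a set \<Rightarrow> 'a set set \<Rightarrow> ('a \<Rightarrow> 'a) set" where
  "graph_auto V E = {\<sigma> \<in> Bij V. \<forall>x\<in>V. \<forall>y\<in>V. {x, y} \<in> E \<longleftrightarrow> {\<sigma> x, \<sigma> y} \<in> E}"

definition GraphAut :: "'a set \<Rightarrow> 'a set set \<Rightarrow> ('a \<Rightarrow> 'a) monoid" where
  "GraphAut V E = BijGroup V \<lparr>carrier := graph_auto V E\<rparr>"

lemma subgroup_graph_auto: "subgroup (graph_auto V E) (BijGroup V)"
proof (rule group.subgroupI[OF group_BijGroup])
  show "graph_auto V E \<subseteq> carrier (BijGroup V)"
    by (auto simp: graph_auto_def BijGroup_def)
  have "(\<lambda>x\<in>V. x) \<in> graph_auto V E"
    by (auto simp: graph_auto_def id_Bij)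
  then show "graph_auto V E \<noteq> {}" by blast
next
  fix s assume s: "s \<in> graph_auto V E"
  then have sB: "s \<in> Bij V" by (simp add: graph_auto_def)
  have si: "s (inv_into V s x) = x" "inv_into V s x \<in> V" if "x \<in> V" for x
    using sB that by (auto simp: Bij_def bij_betw_def f_inv_into_f inv_into_into)
  have "{x, y} \<in> E \<longleftrightarrow> {inv_into V s x, inv_into V s y} \<in> E" if "x \<in> V" "y \<in> V" for x y
    using s si[OF that(1)] si[OF that(2)] unfolding graph_auto_def by fastforce
  then show "inv\<^bsub>BijGroup V\<^esub> s \<in> graph_auto V E"
    using sB by (simp add: graph_auto_def inv_BijGroup restrict_inv_into_Bij)
next
  fix s t assume st: "s \<in> graph_auto V E" "t \<in> graph_auto V E"
  then have B: "s \<in> Bij V" "t \<in> Bij V" by (simp_all add: graph_auto_def)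
  have tV: "t x \<in> V" if "x \<in> V" for x
    using B that Bij_imp_funcset by fastforce
  have "s \<otimes>\<^bsub>BijGroup V\<^esub> t = compose V s t"
    using B by (simp add: BijGroup_def)
  moreover have "compose V s t \<in> graph_auto V E"
    unfolding graph_auto_def mem_Collect_eq
  proof (intro conjI ballI)
    show "compose V s t \<in> Bij V" using B by (rule compose_Bij)
    fix x y assume xy: "x \<in> V" "y \<in> V"
    have "{x, y} \<in> E \<longleftrightarrow> {t x, t y} \<in> E"
      using st(2) xy unfolding graph_auto_def by blast
    also have "\<dots> \<longleftrightarrow> {s (t x), s (t y)} \<in> E"
      using st(1) tV[OF xy(1)] tV[OF xy(2)] unfolding graph_auto_def by blast
    finally show "{x, y} \<in> E \<longleftrightarrow> {compose V s t x, compose V s t y} \<in> E"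
      using xy by (simp add: compose_def)
  qed
  ultimately show "s \<otimes>\<^bsub>BijGroup V\<^esub> t \<in> graph_auto V E" by simp
qed

lemma group_GraphAut: "group (GraphAut V E)"
  unfolding GraphAut_def
  by (rule subgroup.subgroup_is_group[OF subgroup_graph_auto group_BijGroup])

definition aut_div :: "('a \<Rightarrow> 'a) \<Rightarrow> ('a \<Rightarrow>\<^sub>0 int) \<Rightarrow> ('a \<Rightarrow>\<^sub>0 int)" where
  "aut_div \<sigma> D = frag_extend (\<lambda>P. frag_of (\<sigma> P)) D"

definition vert_orbit :: "('a \<Rightarrow> 'a) set \<Rightarrow> 'a \<Rightarrow> 'a set" where
  "vert_orbit \<Gamma> P = {\<sigma> P | \<sigma>. \<sigma> \<in> \<Gamma>}"

definition edge_orbit :: "('a \<Rightarrow> 'a) set \<Rightarrow> 'a set \<Rightarrow> 'a set set" where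
  "edge_orbit \<Gamma> e = {\<sigma> ` e | \<sigma>. \<sigma> \<in> \<Gamma>}"

definition crossing :: "('a \<Rightarrow> 'a) set \<Rightarrow> 'a set \<Rightarrow> bool" where
  "crossing \<Gamma> e \<longleftrightarrow> (\<exists>P\<in>e. \<exists>Q\<in>e. vert_orbit \<Gamma> P \<noteq> vert_orbit \<Gamma> Q)"

definition quot_verts :: "'a set \<Rightarrow> ('a \<Rightarrow> 'a) set \<Rightarrow> 'a set set" where
  "quot_verts V \<Gamma> = vert_orbit \<Gamma> ` V"

text \<open>An edge of the quotient graph is an orbit of edges, not the pair of its endpoints, so
  parallel edges remain distinct.\<close>

definition quot_edges :: "'a set set \<Rightarrow> ('a \<Rightarrow> 'a) set \<Rightarrow> 'a set set set" where
  "quot_edges E \<Gamma> = {edge_orbit \<Gamma> e | e. e \<in> E \<and> crossing \<Gamma> e}"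

text \<open>\<open>\<Union>e'\<close> consists of the endpoints of all edges in the orbit \<open>e'\<close>; all
  these edges have the same two vertex orbits as endpoints.\<close>

definition quot_ends :: "('a \<Rightarrow> 'a) set \<Rightarrow> 'a set set \<Rightarrow> 'a set set" where
  "quot_ends \<Gamma> e' = vert_orbit \<Gamma> ` (\<Union>e')"

text \<open>The quotient map on edges: \<open>Inl\<close> marks vertices and \<open>Inr\<close> edges of the quotient
  graph. On vertices the quotient map is \<^const>\<open>vert_orbit\<close>.\<close>

definition quot_map_edge :: "('a \<Rightarrow> 'a) set \<Rightarrow> 'a set \<Rightarrow> 'a set + 'a set set" where
  "quot_map_edge \<Gamma> e =
     (if crossing \<Gamma> e then Inr (edge_orbit \<Gamma> e)
      else Inl (THE v. \<forall>P\<in>e. vert_orbit \<Gamma> P = v))"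

definition harmonic_quotient :: "'a set \<Rightarrow> 'a set set \<Rightarrow> ('a \<Rightarrow> 'a) set \<Rightarrow> bool" where
  "harmonic_quotient V E \<Gamma> \<longleftrightarrow>
     (\<forall>P\<in>V. \<forall>e'\<in>quot_edges E \<Gamma>. \<forall>e''\<in>quot_edges E \<Gamma>.
        vert_orbit \<Gamma> P \<in> quot_ends \<Gamma> e' \<and> vert_orbit \<Gamma> P \<in> quot_ends \<Gamma> e'' \<longrightarrow>
        card {e \<in> E. P \<in> e \<and> quot_map_edge \<Gamma> e = Inr e'} =
        card {e \<in> E. P \<in> e \<and> quot_map_edge \<Gamma> e = Inr e''})"

definition acts_harmonically :: "'a set \<Rightarrow> 'a set set \<Rightarrow> ('a \<Rightarrow> 'a) set \<Rightarrow> bool" where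
  "acts_harmonically V E \<Gamma> \<longleftrightarrow>
     subgroup \<Gamma> (GraphAut V E) \<and>
     (\<forall>\<Lambda>. subgroup \<Lambda> (GraphAut V E) \<and> \<Lambda> \<subseteq> \<Gamma> \<longrightarrow> harmonic_quotient V E \<Lambda>)"


section \<open>Galois points\<close>

definition galois_point :: "'a set \<Rightarrow> 'a set set \<Rightarrow> ('a \<Rightarrow>\<^sub>0 int) \<Rightarrow> 'a \<Rightarrow> bool" where
  "galois_point V E D P \<longleftrightarrow>
     two_edge_connected V E \<and> D \<in> Divs V \<and> div_rank V E D = 2 \<and> P \<in> V \<and>
     div_rank V E (D - frag_of P) = 1 \<and>
     (\<forall>Q\<in>V. div_rank V E (D - frag_of P - frag_of Q) = 0) \<and>
     (\<exists>H E1 E2. subgroup H (GraphAut V E) \<and>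
        int (card H) = div_deg V D - 1 \<and>
        E1 \<in> linear_system V E (D - frag_of P) \<and>
        E2 \<in> linear_system V E (D - frag_of P) \<and>
        E1 \<noteq> E2 \<and>
        card (quot_verts V H) > 1 \<and>
        acts_harmonically V E H \<and>
        (\<forall>\<sigma>\<in>H. aut_div \<sigma> E1 = E1 \<and> aut_div \<sigma> E2 = E2))"

end

theory Submission
  imports Defs
begin

text \<open>Let \<open>D\<close> be the sum of all \<open>n\<close> vertices, \<open>P\<close> a Galois point and \<open>H\<close> its group, of order
  \<open>n - 1\<close>. Since \<open>D\<close> is invariant under every automorphism and \<open>H\<close> fixes a divisor in the class of
  \<open>D - P\<close>, each \<open>\<sigma> \<in> H\<close> satisfies \<open>\<sigma>(P) \<sim> P\<close>, which in a 2-edge-connected graph means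
  \<open>\<sigma>(P) = P\<close>. A nontrivial element of a harmonically acting group cannot fix both ends of an edge.
  Hence the orbit of a neighbour of \<open>P\<close> has \<open>n - 1\<close> elements: \<open>P\<close> is adjacent to all other
  vertices and automorphisms fixing \<open>P\<close> permute these transitively. Two such vertices make the graph
  complete; the ranks play no role in this direction.

  In the complete graph the ranks follow from two facts: \<open>D - P - Q\<close> is always equivalent to an
  effective divisor, while \<open>D - 2P - Q\<close> is not if \<open>P \<noteq> Q\<close>. A cyclic group permuting
  \<open>V - {P}\<close> regularly fixes \<open>D - P\<close> and \<open>(n - 1)P\<close>, which are equivalent.\<close>

section \<open>Divisors and the Laplacian\<close>

lemma simple_graph_finite: "simple_graph V E \<Longrightarrow> finite V"
  by (simp add: simple_graph_def)

lemma simple_graph_edgeD: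
  assumes "simple_graph V E" "{x, y} \<in> E"
  shows "x \<in> V" "y \<in> V" "x \<noteq> y"
proof -
  have "{x, y} \<subseteq> V" "card {x, y} = 2"
    using assms unfolding simple_graph_def by blast+
  then show "x \<in> V" "y \<in> V" "x \<noteq> y"
    by (auto simp: card_insert_if)
qed

lemma simple_graph_edgeE:
  assumes "simple_graph V E" "e \<in> E"
  obtains x y where "e = {x, y}" "x \<in> V" "y \<in> V" "x \<noteq> y"
proof -
  have "card e = 2" "e \<subseteq> V"
    using assms by (auto simp: simple_graph_def)
  then show thesis
    using that by (auto simp: card_2_iff)
qed

lemma finite_neighbours: "simple_graph V E \<Longrightarrow> finite {y. {x, y} \<in> E}"
  by (rule finite_subset[OF _ simple_graph_finite]) (auto dest: simple_graph_edgeD)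

lemma lookup_laplacian:
  assumes "finite V"
  shows "Poly_Mapping.lookup (laplacian V E f) x =
    (if x \<in> V then \<Sum>y\<in>{y. {x, y} \<in> E}. f x - f y else 0)"
  using assms unfolding laplacian_def lookup_sum lookup_frag_cmul lookup_frag_of
  by (simp add: if_distrib[where f = "\<lambda>a. _ * a"] cong: if_cong)

lemma laplacian_diff:
  "laplacian V E f - laplacian V E g = laplacian V E (\<lambda>x. f x - g x)"
  unfolding laplacian_def sum_subtractf[symmetric] frag_cmul_diff_distrib[symmetric]
  by (simp add: algebra_simps)

text \<open>An effective divisor equivalent to \<open>D\<close> is determined by its function
  \<open>f\<close> as \<open>D + laplacian V E f\<close>, so only \<open>f\<close> has to be found.
  Later questions about effectivity thereby become inequalities at single vertices.\<close>

lemma linear_system_nonempty_iff: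
  assumes "finite V" "D \<in> Divs V"
  shows "linear_system V E D \<noteq> {} \<longleftrightarrow>
    (\<exists>f. \<forall>x\<in>V. 0 \<le> Poly_Mapping.lookup D x + (\<Sum>y\<in>{y. {x, y} \<in> E}. f x - f y))"
proof
  assume "linear_system V E D \<noteq> {}"
  then obtain F f where F: "effective F" "F - D = laplacian V E f"
    unfolding linear_system_def lin_equiv_def by blast
  then have "F = D + laplacian V E f"
    by (simp add: algebra_simps)
  then have "\<forall>x\<in>V. 0 \<le> Poly_Mapping.lookup D x + (\<Sum>y\<in>{y. {x, y} \<in> E}. f x - f y)"
    using F(1) assms(1) by (auto simp: effective_def lookup_add lookup_laplacian dest: spec)
  then show "\<exists>f. \<forall>x\<in>V. 0 \<le> Poly_Mapping.lookup D x + (\<Sum>y\<in>{y. {x, y} \<in> E}. f x - f y)"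
    by blast
next
  assume "\<exists>f. \<forall>x\<in>V. 0 \<le> Poly_Mapping.lookup D x + (\<Sum>y\<in>{y. {x, y} \<in> E}. f x - f y)"
  then obtain f
    where f: "\<And>x. x \<in> V \<Longrightarrow> 0 \<le> Poly_Mapping.lookup D x + (\<Sum>y\<in>{y. {x, y} \<in> E}. f x - f y)"
    by blast
  define F where "F = D + laplacian V E f"
  \<comment> \<open>\<open>effective\<close> ranges over the whole type and \<open>Divs V\<close>
    requires support in \<open>V\<close>; vanishing outside \<open>V\<close> serves both.\<close>
  have outside: "Poly_Mapping.lookup F x = 0" if "x \<notin> V" for x
  proof -
    have "Poly_Mapping.lookup D x = 0"
      using assms(2) that by (auto simp: in_keys_iff subset_iff)
    then show ?thesis
      using that assms(1) by (simp add: F_def lookup_add lookup_laplacian)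
  qed
  have "effective F"
    unfolding effective_def
  proof
    fix x show "0 \<le> Poly_Mapping.lookup F x"
      using f[of x] outside[of x] assms(1)
      by (cases "x \<in> V") (auto simp: F_def lookup_add lookup_laplacian)
  qed
  moreover have "F \<in> Divs V"
    using outside by (auto simp: in_keys_iff)
  moreover have "lin_equiv V E F D"
    unfolding lin_equiv_def F_def by auto
  ultimately show "linear_system V E D \<noteq> {}"
    by (auto simp: linear_system_def)
qed


section \<open>Rank\<close>

text \<open>This is the predicate that \<open>GREATEST\<close> maximises in \<open>div_rank\<close>;
  a name for it allows induction on \<open>s\<close>.\<close>

definition rank_at_least :: "'a set \<Rightarrow> 'a set set \<Rightarrow> nat \<Rightarrow> ('a \<Rightarrow>\<^sub>0 int) \<Rightarrow> bool" where
  "rank_at_least V E s D \<longleftrightarrow>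
    (\<forall>F\<in>Divs V. effective F \<and> div_deg V F = int s \<longrightarrow> linear_system V E (D - F) \<noteq> {})"

lemma Divs_lookup_outside: "F \<in> Divs V \<Longrightarrow> x \<notin> V \<Longrightarrow> Poly_Mapping.lookup F x = 0"
  by (auto simp: in_keys_iff subset_iff)

lemma Divs_diff: "F \<in> Divs V \<Longrightarrow> F' \<in> Divs V \<Longrightarrow> F - F' \<in> Divs V"
  using keys_diff[of F F'] by auto

lemma Divs_add: "F \<in> Divs V \<Longrightarrow> F' \<in> Divs V \<Longrightarrow> F + F' \<in> Divs V"
  using Poly_Mapping.keys_add[of F F'] by auto

lemma Divs_frag_of: "x \<in> V \<Longrightarrow> frag_of x \<in> Divs V"
  by simp

lemma div_deg_add: "div_deg V (F + F') = div_deg V F + div_deg V F'"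
  by (simp add: div_deg_def lookup_add sum.distrib)

lemma div_deg_diff: "div_deg V (F - F') = div_deg V F - div_deg V F'"
  by (simp add: div_deg_def lookup_minus sum_subtractf)

lemma div_deg_frag_of: "finite V \<Longrightarrow> x \<in> V \<Longrightarrow> div_deg V (frag_of x) = 1"
  by (simp add: div_deg_def sum.delta)

text \<open>Nonnegative coefficients with sum 0 all vanish, so the zero divisor is the only one to
  be subtracted.\<close>

lemma rank_at_least_0:
  assumes "finite V"
  shows "rank_at_least V E 0 D \<longleftrightarrow> linear_system V E D \<noteq> {}"
proof -
  have zero: "F = 0" if F: "F \<in> Divs V" "effective F" "div_deg V F = 0" for F :: "'a \<Rightarrow>\<^sub>0 int"
  proof (rule poly_mapping_eqI)
    fix x
    have "\<forall>x\<in>V. Poly_Mapping.lookup F x = 0"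
      using F(2,3) assms sum_nonneg_eq_0_iff[of V "Poly_Mapping.lookup F"]
      by (simp add: div_deg_def effective_def)
    then show "Poly_Mapping.lookup F x = Poly_Mapping.lookup 0 x"
      using Divs_lookup_outside[OF F(1)] by (cases "x \<in> V") auto
  qed
  have "(0 :: 'a \<Rightarrow>\<^sub>0 int) \<in> Divs V" "effective 0" "div_deg V 0 = 0"
    by (simp_all add: effective_def div_deg_def)
  then have "F \<in> Divs V \<and> effective F \<and> div_deg V F = int 0 \<longleftrightarrow> F = 0"
    for F :: "'a \<Rightarrow>\<^sub>0 int"
    using zero[of F] by (metis of_nat_0)
  then show ?thesis
    unfolding rank_at_least_def by (metis diff_zero)
qed

text \<open>An effective divisor of positive degree has a vertex with positive coefficient, which
  can be split off. Repeated use reduces a rank to the question which divisors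
  \<open>D - frag_of x - frag_of y - ...\<close> have nonempty linear systems.\<close>

lemma rank_at_least_Suc:
  assumes "finite V"
  shows "rank_at_least V E (Suc s) D \<longleftrightarrow> (\<forall>x\<in>V. rank_at_least V E s (D - frag_of x))"
proof
  assume *: "rank_at_least V E (Suc s) D"
  show "\<forall>x\<in>V. rank_at_least V E s (D - frag_of x)"
    unfolding rank_at_least_def
  proof (intro ballI impI)
    fix x F assume x: "x \<in> V" and F: "F \<in> Divs V" "effective F \<and> div_deg V F = int s"
    have "effective (F + frag_of x)" "F + frag_of x \<in> Divs V"
      using F Divs_add[OF F(1) Divs_frag_of[OF x]] by (auto simp: effective_def lookup_add)
    moreover have "div_deg V (F + frag_of x) = int (Suc s)"
      using F x assms by (simp add: div_deg_add div_deg_frag_of)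
    ultimately have "linear_system V E (D - (F + frag_of x)) \<noteq> {}"
      using * unfolding rank_at_least_def by blast
    then show "linear_system V E (D - frag_of x - F) \<noteq> {}"
      by (simp add: algebra_simps)
  qed
next
  assume *: "\<forall>x\<in>V. rank_at_least V E s (D - frag_of x)"
  show "rank_at_least V E (Suc s) D"
    unfolding rank_at_least_def
  proof (intro ballI impI)
    fix F assume F: "F \<in> Divs V" "effective F \<and> div_deg V F = int (Suc s)"
    have "\<exists>x\<in>V. Poly_Mapping.lookup F x > 0"
    proof (rule ccontr)
      assume "\<not> ?thesis"
      then have "div_deg V F \<le> 0"
        unfolding div_deg_def by (intro sum_nonpos) (simp add: not_less)
      then show False
        using F(2) by simp
    qed
    then obtain x where x: "x \<in> V" "Poly_Mapping.lookup F x > 0"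
      by blast
    have "effective (F - frag_of x)"
      using F x by (auto simp: effective_def lookup_minus)
    moreover have "F - frag_of x \<in> Divs V"
      by (rule Divs_diff[OF F(1) Divs_frag_of[OF x(1)]])
    moreover have "div_deg V (F - frag_of x) = int s"
      using F x assms by (simp add: div_deg_diff div_deg_frag_of)
    ultimately have "linear_system V E (D - frag_of x - (F - frag_of x)) \<noteq> {}"
      using * x(1) unfolding rank_at_least_def by blast
    then show "linear_system V E (D - F) \<noteq> {}"
      by (simp add: algebra_simps)
  qed
qed

text \<open>The same function \<open>f\<close> works, since putting the chip at \<open>x\<close>
  back lowers no coefficient.\<close>

lemma linear_system_nonempty_add:
  assumes "finite V" "D \<in> Divs V" "x \<in> V" "linear_system V E (D - frag_of x) \<noteq> {}"
  shows "linear_system V E D \<noteq> {}"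
proof -
  obtain f where "\<forall>z\<in>V. 0 \<le> Poly_Mapping.lookup (D - frag_of x) z + (\<Sum>y\<in>{y. {z, y} \<in> E}. f z - f y)"
    using assms(4)
    unfolding linear_system_nonempty_iff[OF assms(1) Divs_diff[OF assms(2) Divs_frag_of[OF assms(3)]]]
    by blast
  moreover have "Poly_Mapping.lookup (D - frag_of x) z \<le> Poly_Mapping.lookup D z" for z
    by (simp add: lookup_minus)
  ultimately have "\<forall>z\<in>V. 0 \<le> Poly_Mapping.lookup D z + (\<Sum>y\<in>{y. {z, y} \<in> E}. f z - f y)"
    by (meson add_right_mono order_trans)
  then show ?thesis
    unfolding linear_system_nonempty_iff[OF assms(1,2)] by blast
qed

text \<open>Induction with \<open>D\<close> arbitrary, because \<open>rank_at_least_Suc\<close>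
  passes to \<open>D - frag_of x\<close>. In the base case a chip removed at some vertex is put
  back; \<open>V \<noteq> {}\<close> provides the vertex.\<close>

lemma rank_at_least_SucD:
  assumes "finite V" "V \<noteq> {}" "D \<in> Divs V" "rank_at_least V E (Suc s) D"
  shows "rank_at_least V E s D"
  using assms(3,4)
proof (induction s arbitrary: D)
  case 0
  then show ?case
    using assms(2) linear_system_nonempty_add[OF assms(1) 0(1)]
    by (auto simp: rank_at_least_0[OF assms(1)] rank_at_least_Suc[OF assms(1)])
next
  case (Suc s)
  then show ?case
    using Divs_diff[OF Suc.prems(1) Divs_frag_of] unfolding rank_at_least_Suc[OF assms(1)] by blast
qed

lemma rank_at_least_mono:
  assumes "finite V" "V \<noteq> {}" "D \<in> Divs V" "rank_at_least V E t D" "s \<le> t"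
  shows "rank_at_least V E s D"
  using assms(5,4) by (induction s rule: inc_induct) (use rank_at_least_SucD[OF assms(1-3)] in blast)+

text \<open>By monotonicity, failure at \<open>Suc r\<close> excludes every larger value, and
  success at \<open>r\<close> gives success at 0, that is, a nonempty linear system, which rules out
  the value -1.\<close>

lemma div_rank_eqI:
  assumes "finite V" "V \<noteq> {}" "D \<in> Divs V"
    and "rank_at_least V E r D" "\<not> rank_at_least V E (Suc r) D"
  shows "div_rank V E D = int r"
proof -
  have "linear_system V E D \<noteq> {}"
    using rank_at_least_mono[OF assms(1-4), of 0] rank_at_least_0[OF assms(1)] by blast
  moreover have "(GREATEST s. rank_at_least V E s D) = r"
    using assms(4)
  proof (rule Greatest_equality)
    fix t assume "rank_at_least V E t D"
    then show "t \<le> r"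
      using rank_at_least_mono[OF assms(1-3), of E t "Suc r"] assms(5) not_less_eq_eq by blast
  qed
  ultimately show ?thesis
    unfolding div_rank_def rank_at_least_def by simp
qed


section \<open>Distinct vertices of a 2-edge-connected graph are inequivalent\<close>

text \<open>A path from \<open>A\<close> to a vertex outside must leave \<open>A\<close> at some
  step. In a 2-edge-connected graph the lemma applies once more after the edge found has been
  deleted.\<close>

lemma connected_graph_crossing_edge:
  assumes "connected_graph V E" "A \<subseteq> V" "A \<noteq> {}" "A \<noteq> V"
  obtains u w where "u \<in> A" "w \<notin> A" "{u, w} \<in> E"
proof -
  obtain a b where ab: "a \<in> A" "b \<in> V" "b \<notin> A"
    using assms by blast
  then have "(a, b) \<in> {(u, v). {u, v} \<in> E}\<^sup>*"
    using assms by (auto simp: connected_graph_def)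
  then have "\<exists>u w. u \<in> A \<and> w \<notin> A \<and> {u, w} \<in> E"
    using ab(1,3) by (induction rule: converse_rtrancl_induct) auto
  then show thesis
    using that by blast
qed

text \<open>Firing the set where \<open>f\<close> is maximal sends at least two chips across its boundary,
  whereas \<open>frag_of P - frag_of Q\<close> allows at most one.\<close>

lemma two_edge_connected_frag_of_eq:
  assumes G: "simple_graph V E" "two_edge_connected V E"
    and P: "P \<in> V" and eq: "frag_of P - frag_of Q = laplacian V E f"
  shows "P = Q"
proof (rule ccontr)
  assume "P \<noteq> Q"
  have fin: "finite V" using G(1) by (rule simple_graph_finite)
  let ?L = "\<lambda>x. \<Sum>y\<in>{y. {x, y} \<in> E}. f x - f y"
  have L: "?L x = (if x = P then 1 else 0) - (if x = Q then 1 else 0)" if "x \<in> V" for x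
    using arg_cong[OF eq, of "\<lambda>F. Poly_Mapping.lookup F x"] that fin
    by (simp add: lookup_minus lookup_laplacian)
  define A where "A = {x \<in> V. f x = Max (f ` V)}"
  have max: "f y \<le> Max (f ` V)" if "y \<in> V" for y
    using fin that by simp
  have "Max (f ` V) \<in> f ` V"
    using fin P by (intro Max_in) auto
  then have "A \<noteq> {}" "A \<subseteq> V"
    by (auto simp: A_def)
  have "A \<noteq> V"
  proof
    assume "A = V"
    then have "f x = Max (f ` V)" if "x \<in> V" for x
      using that by (auto simp: A_def)
    then have "?L P = 0"
      using P G(1) by (intro sum.neutral) (auto dest: simple_graph_edgeD)
    then show False
      using L[OF P] \<open>P \<noteq> Q\<close> by simp
  qed
  \<comment> \<open>No neighbour of a vertex of \<open>A\<close> has a larger value, so one edge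
    leaving \<open>A\<close> makes the sum at \<open>u\<close> positive; by \<open>L\<close> this
    happens only at \<open>P\<close>.\<close>
  have ge1: "u = P" if "u \<in> A" "w \<notin> A" "{u, w} \<in> E" for u w
  proof -
    have uw: "u \<in> V" "w \<in> V" using simple_graph_edgeD[OF G(1) that(3)] by auto
    have "f u - f w > 0"
      using that(1,2) uw max[OF uw(2)] by (auto simp: A_def)
    moreover have "f u - f w \<le> ?L u"
    proof (rule member_le_sum)
      show "w \<in> {y. {u, y} \<in> E}" using that by simp
      show "0 \<le> f u - f x" if "x \<in> {y. {u, y} \<in> E} - {w}" for x
        using that \<open>u \<in> A\<close> max simple_graph_edgeD(2)[OF G(1), of u x] by (auto simp: A_def)
    qed (rule finite_neighbours[OF G(1)])
    ultimately show ?thesis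
      using L[OF uw(1)] by (auto split: if_splits)
  qed
  have conn: "connected_graph V E" "\<And>e. e \<in> E \<Longrightarrow> connected_graph V (E - {e})"
    using G(2) by (auto simp: two_edge_connected_def)
  obtain u w where uw: "u \<in> A" "w \<notin> A" "{u, w} \<in> E"
    using connected_graph_crossing_edge[OF conn(1)] \<open>A \<noteq> {}\<close> \<open>A \<subseteq> V\<close> \<open>A \<noteq> V\<close> by blast
  \<comment> \<open>Deleting \<open>{u, w}\<close> keeps the graph connected, so a second edge
    leaves \<open>A\<close>. Both edges start at \<open>P\<close>, hence they end at different
    vertices outside \<open>A\<close>.\<close>
  obtain u' w' where uw': "u' \<in> A" "w' \<notin> A" "{u', w'} \<in> E - {{u, w}}"
    using connected_graph_crossing_edge[OF conn(2)[OF uw(3)]] \<open>A \<noteq> {}\<close> \<open>A \<subseteq> V\<close> \<open>A \<noteq> V\<close> by blast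
  have "u = P" "u' = P"
    using ge1 uw uw' by auto
  with uw uw' have w: "w \<noteq> w'" "{P, w} \<in> E" "{P, w'} \<in> E" "P \<in> A"
    by auto
  have gt: "f P - f x > 0" if "x \<notin> A" "{P, x} \<in> E" for x
    using that \<open>P \<in> A\<close> max[of x] simple_graph_edgeD(2)[OF G(1) that(2)]
    by (auto simp: A_def)
  have "(\<Sum>y\<in>{w, w'}. f P - f y) \<le> ?L P"
  proof (rule sum_mono2[OF finite_neighbours[OF G(1)]])
    show "{w, w'} \<subseteq> {y. {P, y} \<in> E}" using w by auto
    show "0 \<le> f P - f x" if "x \<in> {y. {P, y} \<in> E} - {w, w'}" for x
      using that \<open>P \<in> A\<close> max simple_graph_edgeD(2)[OF G(1), of P x] by (auto simp: A_def)
  qed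
  then have "(f P - f w) + (f P - f w') \<le> ?L P"
    using w(1) by simp
  moreover have "?L P \<le> 1"
    using L[OF P] by simp
  ultimately show False
    using gt[OF uw(2) w(2)] gt[OF uw'(2) w(3)] by linarith
qed


section \<open>Harmonic actions\<close>

lemma GraphAut_simps:
  "carrier (GraphAut V E) = graph_auto V E"
  "\<one>\<^bsub>GraphAut V E\<^esub> = (\<lambda>x\<in>V. x)"
  "\<sigma> \<in> graph_auto V E \<Longrightarrow> \<tau> \<in> graph_auto V E \<Longrightarrow> \<sigma> \<otimes>\<^bsub>GraphAut V E\<^esub> \<tau> = compose V \<sigma> \<tau>"
  by (simp_all add: GraphAut_def BijGroup_def graph_auto_def)

lemma graph_autoD:
  assumes "\<sigma> \<in> graph_auto V E"
  shows "bij_betw \<sigma> V V" "\<sigma> \<in> extensional V" "\<And>x. x \<in> V \<Longrightarrow> \<sigma> x \<in> V"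
    "\<And>x y. x \<in> V \<Longrightarrow> y \<in> V \<Longrightarrow> {\<sigma> x, \<sigma> y} \<in> E \<longleftrightarrow> {x, y} \<in> E"
  using assms by (auto simp: graph_auto_def Bij_def dest: bij_betwE)

text \<open>A left inverse in a group is the inverse, so closure under inverses can be checked
  pointwise on \<open>V\<close> without computing \<open>inv\<close>.\<close>

lemma GraphAut_subgroupI:
  assumes "\<Lambda> \<subseteq> graph_auto V E" "(\<lambda>x\<in>V. x) \<in> \<Lambda>"
    and "\<And>\<sigma> \<tau>. \<sigma> \<in> \<Lambda> \<Longrightarrow> \<tau> \<in> \<Lambda> \<Longrightarrow> compose V \<sigma> \<tau> \<in> \<Lambda>"
    and "\<And>\<sigma>. \<sigma> \<in> \<Lambda> \<Longrightarrow> \<exists>\<tau>\<in>\<Lambda>. \<forall>x\<in>V. \<tau> (\<sigma> x) = x"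
  shows "subgroup \<Lambda> (GraphAut V E)"
proof (rule group.subgroupI[OF group_GraphAut])
  show "\<Lambda> \<subseteq> carrier (GraphAut V E)" using assms(1) by (simp add: GraphAut_simps)
  show "\<Lambda> \<noteq> {}" using assms(2) by blast
  show "\<sigma> \<otimes>\<^bsub>GraphAut V E\<^esub> \<tau> \<in> \<Lambda>" if "\<sigma> \<in> \<Lambda>" "\<tau> \<in> \<Lambda>" for \<sigma> \<tau>
  proof -
    have "\<sigma> \<in> graph_auto V E" "\<tau> \<in> graph_auto V E"
      using that assms(1) by auto
    then show ?thesis
      using that assms(3) by (simp add: GraphAut_simps)
  qed
  show "inv\<^bsub>GraphAut V E\<^esub> \<sigma> \<in> \<Lambda>" if \<sigma>: "\<sigma> \<in> \<Lambda>" for \<sigma>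
  proof -
    obtain \<tau> where \<tau>: "\<tau> \<in> \<Lambda>" "\<forall>x\<in>V. \<tau> (\<sigma> x) = x"
      using assms(4)[OF \<sigma>] by blast
    have mem: "\<sigma> \<in> graph_auto V E" "\<tau> \<in> graph_auto V E"
      using \<sigma> \<tau>(1) assms(1) by auto
    have "compose V \<tau> \<sigma> = (\<lambda>x\<in>V. x)"
      using \<tau>(2) by (auto simp: compose_def fun_eq_iff restrict_def)
    then have "inv\<^bsub>GraphAut V E\<^esub> \<sigma> = \<tau>"
      using mem by (intro group.inv_equality[OF group_GraphAut]) (simp_all add: GraphAut_simps)
    then show ?thesis using \<tau>(1) by simp
  qed
qed

lemma GraphAut_subgroupD:
  assumes "subgroup \<Lambda> (GraphAut V E)"
  shows "\<Lambda> \<subseteq> graph_auto V E" "(\<lambda>x\<in>V. x) \<in> \<Lambda>"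
    and "\<And>\<sigma> \<tau>. \<sigma> \<in> \<Lambda> \<Longrightarrow> \<tau> \<in> \<Lambda> \<Longrightarrow> compose V \<sigma> \<tau> \<in> \<Lambda>"
proof -
  show sub: "\<Lambda> \<subseteq> graph_auto V E"
    using subgroup.subset[OF assms] by (simp add: GraphAut_simps)
  show "(\<lambda>x\<in>V. x) \<in> \<Lambda>"
    using subgroup.one_closed[OF assms] by (simp add: GraphAut_simps)
  show "compose V \<sigma> \<tau> \<in> \<Lambda>" if "\<sigma> \<in> \<Lambda>" "\<tau> \<in> \<Lambda>" for \<sigma> \<tau>
  proof -
    have "\<sigma> \<in> graph_auto V E" "\<tau> \<in> graph_auto V E"
      using that sub by auto
    then show ?thesis
      using subgroup.m_closed[OF assms that] by (simp add: GraphAut_simps)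
  qed
qed

lemma GraphAut_subgroup_inverse:
  assumes \<Lambda>: "subgroup \<Lambda> (GraphAut V E)" and \<sigma>: "\<sigma> \<in> \<Lambda>"
  obtains \<tau> where "\<tau> \<in> \<Lambda>" "\<forall>x\<in>V. \<tau> (\<sigma> x) = x" "\<forall>x\<in>V. \<sigma> (\<tau> x) = x"
proof -
  let ?\<tau> = "inv\<^bsub>GraphAut V E\<^esub> \<sigma>"
  have \<tau>: "?\<tau> \<in> \<Lambda>"
    by (rule subgroup.m_inv_closed[OF \<Lambda> \<sigma>])
  have mem: "\<sigma> \<in> graph_auto V E" "?\<tau> \<in> graph_auto V E"
    using \<sigma> \<tau> GraphAut_subgroupD(1)[OF \<Lambda>] by auto
  then have "compose V ?\<tau> \<sigma> = (\<lambda>x\<in>V. x)" "compose V \<sigma> ?\<tau> = (\<lambda>x\<in>V. x)"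
    using group.l_inv[OF group_GraphAut, of \<sigma> V E] group.r_inv[OF group_GraphAut, of \<sigma> V E]
    by (simp_all add: GraphAut_simps)
  then have "\<forall>x\<in>V. ?\<tau> (\<sigma> x) = x" "\<forall>x\<in>V. \<sigma> (?\<tau> x) = x"
    by (metis compose_eq restrict_apply')+
  then show thesis
    using that \<tau> by blast
qed

section \<open>Orbits of vertices and edges\<close>

lemma vert_orbit_refl:
  assumes "subgroup \<Lambda> (GraphAut V E)" "x \<in> V"
  shows "x \<in> vert_orbit \<Lambda> x"
proof -
  have "x = (\<lambda>x\<in>V. x) x"
    using assms(2) by simp
  then show ?thesis
    using GraphAut_subgroupD(2)[OF assms(1)] unfolding vert_orbit_def by blast
qed

lemma edge_orbit_refl:
  assumes "subgroup \<Lambda> (GraphAut V E)" "e \<subseteq> V"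
  shows "e \<in> edge_orbit \<Lambda> e"
proof -
  have "(\<lambda>x\<in>V. x) ` e = e"
    using image_cong[of e e "\<lambda>x\<in>V. x" id] assms(2) by auto
  then show ?thesis
    using GraphAut_subgroupD(2)[OF assms(1)] unfolding edge_orbit_def by blast
qed

text \<open>Composing the elements of \<open>\<Lambda>\<close> with \<open>\<sigma>\<close> on the
  right stays in \<open>\<Lambda>\<close>; the inverse of \<open>\<sigma>\<close> gives the reverse
  inclusion.\<close>

lemma vert_orbit_image:
  assumes \<Lambda>: "subgroup \<Lambda> (GraphAut V E)" and "\<sigma> \<in> \<Lambda>" "x \<in> V"
  shows "vert_orbit \<Lambda> (\<sigma> x) = vert_orbit \<Lambda> x"
proof
  show "vert_orbit \<Lambda> (\<sigma> x) \<subseteq> vert_orbit \<Lambda> x"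
  proof
    fix y assume "y \<in> vert_orbit \<Lambda> (\<sigma> x)"
    then obtain \<rho> where "\<rho> \<in> \<Lambda>" "y = \<rho> (\<sigma> x)"
      by (auto simp: vert_orbit_def)
    then have "y = compose V \<rho> \<sigma> x" "compose V \<rho> \<sigma> \<in> \<Lambda>"
      using assms GraphAut_subgroupD(3)[OF \<Lambda>] by (simp_all add: compose_eq)
    then show "y \<in> vert_orbit \<Lambda> x"
      by (auto simp: vert_orbit_def)
  qed
  show "vert_orbit \<Lambda> x \<subseteq> vert_orbit \<Lambda> (\<sigma> x)"
  proof
    fix y assume "y \<in> vert_orbit \<Lambda> x"
    then obtain \<rho> where \<rho>: "\<rho> \<in> \<Lambda>" "y = \<rho> x"
      by (auto simp: vert_orbit_def)
    obtain \<tau> where \<tau>: "\<tau> \<in> \<Lambda>" "\<forall>x\<in>V. \<tau> (\<sigma> x) = x"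
        by (rule GraphAut_subgroup_inverse[OF \<Lambda> \<open>\<sigma> \<in> \<Lambda>\<close>])
    have "\<sigma> \<in> graph_auto V E"
      using assms(2) GraphAut_subgroupD(1)[OF \<Lambda>] by blast
    then have "\<sigma> x \<in> V"
      using assms(3) by (rule graph_autoD(3))
    then have "y = compose V \<rho> \<tau> (\<sigma> x)"
      using \<rho>(2) \<tau>(2) assms(3) by (simp add: compose_eq)
    then show "y \<in> vert_orbit \<Lambda> (\<sigma> x)"
      using GraphAut_subgroupD(3)[OF \<Lambda> \<rho>(1) \<tau>(1)] by (auto simp: vert_orbit_def)
  qed
qed

lemma edge_orbit_image:
  assumes \<Lambda>: "subgroup \<Lambda> (GraphAut V E)" and "\<sigma> \<in> \<Lambda>" "e \<subseteq> V"
  shows "edge_orbit \<Lambda> (\<sigma> ` e) = edge_orbit \<Lambda> e"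
proof
  show "edge_orbit \<Lambda> (\<sigma> ` e) \<subseteq> edge_orbit \<Lambda> e"
  proof
    fix y assume "y \<in> edge_orbit \<Lambda> (\<sigma> ` e)"
    then obtain \<rho> where \<rho>: "\<rho> \<in> \<Lambda>" "y = \<rho> ` \<sigma> ` e"
      by (auto simp: edge_orbit_def)
    have "compose V \<rho> \<sigma> ` e = \<rho> ` \<sigma> ` e"
      unfolding image_image using assms(3) by (intro image_cong refl compose_eq) blast
    then show "y \<in> edge_orbit \<Lambda> e"
      using \<rho> GraphAut_subgroupD(3)[OF \<Lambda> \<rho>(1) assms(2)] unfolding edge_orbit_def by blast
  qed
  show "edge_orbit \<Lambda> e \<subseteq> edge_orbit \<Lambda> (\<sigma> ` e)"
  proof
    fix y assume "y \<in> edge_orbit \<Lambda> e"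
    then obtain \<rho> where \<rho>: "\<rho> \<in> \<Lambda>" "y = \<rho> ` e"
      by (auto simp: edge_orbit_def)
    obtain \<tau> where \<tau>: "\<tau> \<in> \<Lambda>" "\<forall>x\<in>V. \<tau> (\<sigma> x) = x"
        by (rule GraphAut_subgroup_inverse[OF \<Lambda> \<open>\<sigma> \<in> \<Lambda>\<close>])
    have \<sigma>: "\<sigma> \<in> graph_auto V E"
      using assms(2) GraphAut_subgroupD(1)[OF \<Lambda>] by blast
    have "compose V \<rho> \<tau> (\<sigma> x) = \<rho> x" if "x \<in> e" for x
      using that assms(3) \<tau>(2) graph_autoD(3)[OF \<sigma>, of x] by (auto simp: compose_eq)
    then have "compose V \<rho> \<tau> ` \<sigma> ` e = \<rho> ` e"
      unfolding image_image by (intro image_cong refl)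
    then show "y \<in> edge_orbit \<Lambda> (\<sigma> ` e)"
      using \<rho> GraphAut_subgroupD(3)[OF \<Lambda> \<rho>(1) \<tau>(1)] unfolding edge_orbit_def by blast
  qed
qed

section \<open>Elements that fix an edge, and harmonic quotients\<close>

lemma crossing_pair: "crossing \<Lambda> {x, y} \<longleftrightarrow> vert_orbit \<Lambda> x \<noteq> vert_orbit \<Lambda> y"
  by (auto simp: crossing_def)

lemma quot_map_edge_eq_Inr:
  "quot_map_edge \<Lambda> e = Inr o' \<longleftrightarrow> crossing \<Lambda> e \<and> edge_orbit \<Lambda> e = o'"
  by (simp add: quot_map_edge_def)

lemma finite_edges: "simple_graph V E \<Longrightarrow> finite E"
  by (rule finite_subset[of _ "Pow V"]) (auto simp: simple_graph_def)

text \<open>Since the edge \<open>PQ\<close> is fixed, exactly one edge at \<open>P\<close> lies over its image, so the same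
  holds for every other edge at \<open>P\<close>.\<close>

lemma harmonic_quotient_fixes_neighbours:
  assumes G: "simple_graph V E" and \<Lambda>: "subgroup \<Lambda> (GraphAut V E)"
    and harm: "harmonic_quotient V E \<Lambda>"
    and fix_P: "\<And>\<sigma>. \<sigma> \<in> \<Lambda> \<Longrightarrow> \<sigma> P = P" and fix_Q: "\<And>\<sigma>. \<sigma> \<in> \<Lambda> \<Longrightarrow> \<sigma> Q = Q"
    and PQ: "{P, Q} \<in> E" and PR: "{P, R} \<in> E" and \<sigma>: "\<sigma> \<in> \<Lambda>"
  shows "\<sigma> R = R"
proof -
  note inV = simple_graph_edgeD[OF G PQ] simple_graph_edgeD[OF G PR]
  have \<sigma>G: "\<sigma> \<in> graph_auto V E"
    using \<sigma> GraphAut_subgroupD(1)[OF \<Lambda>] by blast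
  have orbP: "vert_orbit \<Lambda> P = {P}"
  proof
    show "vert_orbit \<Lambda> P \<subseteq> {P}"
      using fix_P by (auto simp: vert_orbit_def)
    show "{P} \<subseteq> vert_orbit \<Lambda> P"
      using vert_orbit_refl[OF \<Lambda> inV(1)] by simp
  qed
  have cross: "crossing \<Lambda> {P, S}" if "{P, S} \<in> E" for S
    using that vert_orbit_refl[OF \<Lambda>, of S] simple_graph_edgeD[OF G that]
    by (auto simp: crossing_pair orbP)
  have ends: "edge_orbit \<Lambda> {P, S} \<in> quot_edges E \<Lambda>"
      "vert_orbit \<Lambda> P \<in> quot_ends \<Lambda> (edge_orbit \<Lambda> {P, S})" if "{P, S} \<in> E" for S
  proof -
    show "edge_orbit \<Lambda> {P, S} \<in> quot_edges E \<Lambda>"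
      using cross[OF that] that by (auto simp: quot_edges_def)
    have "{P, S} \<in> edge_orbit \<Lambda> {P, S}"
      using edge_orbit_refl[OF \<Lambda>] simple_graph_edgeD[OF G that] by simp
    then show "vert_orbit \<Lambda> P \<in> quot_ends \<Lambda> (edge_orbit \<Lambda> {P, S})"
      unfolding quot_ends_def by blast
  qed
  let ?N = "\<lambda>S. {e \<in> E. P \<in> e \<and> quot_map_edge \<Lambda> e = Inr (edge_orbit \<Lambda> {P, S})}"
  have "\<rho> ` {P, Q} = {P, Q}" if "\<rho> \<in> \<Lambda>" for \<rho>
    using fix_P[OF that] fix_Q[OF that] by simp
  then have "edge_orbit \<Lambda> {P, Q} \<subseteq> {{P, Q}}"
    unfolding edge_orbit_def by blast
  moreover have "e \<in> edge_orbit \<Lambda> e" if "e \<in> E" for e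
    using edge_orbit_refl[OF \<Lambda>] G that by (simp add: simple_graph_def)
  ultimately have "?N Q \<subseteq> {{P, Q}}"
    unfolding quot_map_edge_eq_Inr by blast
  then have "card (?N Q) \<le> card {{P, Q}}"
    by (rule card_mono[rotated]) simp
  moreover have "card (?N R) = card (?N Q)"
    using harm[unfolded harmonic_quotient_def, rule_format, OF inV(1) ends(1)[OF PR] ends(1)[OF PQ]]
      ends(2)[OF PR] ends(2)[OF PQ] by simp
  ultimately have le: "card (?N R) \<le> Suc 0"
    by simp
  have fin: "finite (?N R)"
    using finite_edges[OF G] by simp
  have R: "{P, R} \<in> ?N R"
    using PR cross[OF PR] by (simp add: quot_map_edge_eq_Inr)
  \<comment> \<open>Since \<open>P\<close> is fixed, the image of the edge \<open>{P, R}\<close> is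
    again an edge at \<open>P\<close> over the same quotient edge. With at most one such edge the
    two coincide.\<close>
  have \<sigma>E: "{P, \<sigma> R} \<in> E"
    using graph_autoD(4)[OF \<sigma>G inV(1) inV(5)] PR fix_P[OF \<sigma>] by simp
  have "edge_orbit \<Lambda> {P, \<sigma> R} = edge_orbit \<Lambda> {P, R}"
    using edge_orbit_image[OF \<Lambda> \<sigma>, of "{P, R}"] inV(1,5) fix_P[OF \<sigma>] by simp
  then have "{P, \<sigma> R} \<in> ?N R"
    using \<sigma>E cross[OF \<sigma>E] by (simp add: quot_map_edge_eq_Inr)
  then have "{P, \<sigma> R} = {P, R}"
    by (rule card_le_Suc0_iff_eq[OF fin, THEN iffD1, OF le, rule_format, OF _ R])
  then show ?thesis
    unfolding doubleton_eq_iff by blast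
qed

text \<open>Fixing both ends of an edge spreads through the graph: the element then fixes all
  further neighbours of each end, every such neighbour gives a new fixed edge, and connectedness
  reaches all vertices.\<close>

lemma acts_harmonically_fixed_edge:
  assumes G: "simple_graph V E" "connected_graph V E" and H: "acts_harmonically V E H"
    and \<sigma>: "\<sigma> \<in> H" "\<sigma> P = P" "\<sigma> Q = Q" and PQ: "{P, Q} \<in> E" and x: "x \<in> V"
  shows "\<sigma> x = x"
proof -
  have sub: "subgroup H (GraphAut V E)"
    using H by (simp add: acts_harmonically_def)
  have propagate: "\<tau> R = R" if \<tau>: "\<tau> \<in> H" "\<tau> A = A" "\<tau> B = B" and AB: "{A, B} \<in> E" and AR: "{A, R} \<in> E"
    for \<tau> A B R
  proof -
    note inV = simple_graph_edgeD[OF G(1) AB]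
    \<comment> \<open>The neighbour lemma needs every group element to fix both ends, so harmonicity
      is used for this stabiliser instead of \<open>H\<close>.\<close>
    define \<Lambda> where "\<Lambda> = {\<rho> \<in> H. \<rho> A = A \<and> \<rho> B = B}"
    have \<Lambda>: "subgroup \<Lambda> (GraphAut V E)"
    proof (rule GraphAut_subgroupI)
      show "\<Lambda> \<subseteq> graph_auto V E" "(\<lambda>x\<in>V. x) \<in> \<Lambda>"
        using GraphAut_subgroupD(1,2)[OF sub] inV(1,2) unfolding \<Lambda>_def by auto
      show "compose V \<rho> \<rho>' \<in> \<Lambda>" if "\<rho> \<in> \<Lambda>" "\<rho>' \<in> \<Lambda>" for \<rho> \<rho>'
        using GraphAut_subgroupD(3)[OF sub, of \<rho> \<rho>'] inV(1,2) that by (simp add: \<Lambda>_def compose_eq)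
      show "\<exists>\<rho>'\<in>\<Lambda>. \<forall>x\<in>V. \<rho>' (\<rho> x) = x" if \<rho>: "\<rho> \<in> \<Lambda>" for \<rho>
      proof -
        have "\<rho> \<in> H" using \<rho> by (simp add: \<Lambda>_def)
        then obtain \<rho>' where \<rho>': "\<rho>' \<in> H" "\<forall>x\<in>V. \<rho>' (\<rho> x) = x"
          by (rule GraphAut_subgroup_inverse[OF sub])
        moreover have "\<rho>' A = A" "\<rho>' B = B"
          using bspec[OF \<rho>'(2) inV(1)] bspec[OF \<rho>'(2) inV(2)] \<rho> by (simp_all add: \<Lambda>_def)
        ultimately have "\<rho>' \<in> \<Lambda>" by (simp add: \<Lambda>_def)
        then show ?thesis using \<rho>'(2) by blast
      qed
    qed
    moreover have "\<Lambda> \<subseteq> H"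
      by (auto simp: \<Lambda>_def)
    ultimately have "harmonic_quotient V E \<Lambda>"
      using H unfolding acts_harmonically_def by blast
    then show ?thesis
      by (rule harmonic_quotient_fixes_neighbours[OF G(1) \<Lambda> _ _ _ AB AR]) (use \<tau> in \<open>simp_all add: \<Lambda>_def\<close>)
  qed
  have "P \<in> V"
    using simple_graph_edgeD[OF G(1) PQ] by simp
  then have "(P, x) \<in> {(u, v). {u, v} \<in> E}\<^sup>*"
    using G(2) x by (simp add: connected_graph_def)
  \<comment> \<open>The induction carries a fixed neighbour along, because \<open>propagate\<close>
    starts from a fixed edge and not from a fixed vertex.\<close>
  then have "\<sigma> x = x \<and> (\<exists>y. {x, y} \<in> E \<and> \<sigma> y = y)"
  proof (induction rule: rtrancl_induct)
    case base
    then show ?case using \<sigma> PQ by blast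
  next
    case (step y z)
    then obtain w where "\<sigma> y = y" "\<sigma> w = w" "{y, w} \<in> E" and yz: "{y, z} \<in> E"
      by blast
    then have "\<sigma> z = z"
      by (rule propagate[OF \<sigma>(1)])
    moreover have "{z, y} \<in> E"
      using yz by (simp add: insert_commute)
    ultimately show ?case
      using \<open>\<sigma> y = y\<close> by blast
  qed
  then show ?thesis by simp
qed

text \<open>The inverse of \<open>\<tau>\<close> composed with \<open>\<sigma>\<close> fixes both
  ends of the edge, hence all of \<open>V\<close>. Automorphisms are extensional, so agreement on
  \<open>V\<close> is equality.\<close>

lemma acts_harmonically_eq_on_edge:
  assumes G: "simple_graph V E" "connected_graph V E" and H: "acts_harmonically V E H"
    and \<sigma>: "\<sigma> \<in> H" "\<tau> \<in> H" "\<sigma> P = \<tau> P" "\<sigma> Q = \<tau> Q" and PQ: "{P, Q} \<in> E"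
  shows "\<sigma> = \<tau>"
proof -
  have sub: "subgroup H (GraphAut V E)"
    using H by (simp add: acts_harmonically_def)
  have aut: "\<sigma> \<in> graph_auto V E" "\<tau> \<in> graph_auto V E"
    using \<sigma> GraphAut_subgroupD(1)[OF sub] by auto
  note inV = simple_graph_edgeD[OF G(1) PQ]
  obtain \<tau>' where \<tau>': "\<tau>' \<in> H" "\<forall>x\<in>V. \<tau>' (\<tau> x) = x" "\<forall>x\<in>V. \<tau> (\<tau>' x) = x"
    by (rule GraphAut_subgroup_inverse[OF sub \<sigma>(2)])
  have "compose V \<tau>' \<sigma> x = x" if "x \<in> V" for x
    using acts_harmonically_fixed_edge[OF G H GraphAut_subgroupD(3)[OF sub \<tau>'(1) \<sigma>(1)] _ _ PQ that]
      inV \<sigma> \<tau>'(2) by (simp add: compose_eq)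
  then have "\<sigma> x = \<tau> x" if "x \<in> V" for x
    using that bspec[OF \<tau>'(3), of "\<sigma> x"] graph_autoD(3)[OF aut(1) that] by (simp add: compose_eq)
  then show ?thesis
    using graph_autoD(2)[OF aut(1)] graph_autoD(2)[OF aut(2)] by (rule extensionalityI[rotated 2])
qed

text \<open>The edges at \<open>P\<close> over a given edge of the quotient form one orbit of the stabiliser of \<open>P\<close>
  and this orbit is regular, so their number does not depend on the given edge.\<close>

lemma harmonic_quotientI:
  assumes G: "simple_graph V E" and \<Lambda>: "subgroup \<Lambda> (GraphAut V E)"
    and free: "\<And>\<sigma> \<tau> x y. \<sigma> \<in> \<Lambda> \<Longrightarrow> \<tau> \<in> \<Lambda> \<Longrightarrow> {x, y} \<in> E \<Longrightarrow> \<sigma> x = \<tau> x \<Longrightarrow> \<sigma> y = \<tau> y \<Longrightarrow> \<sigma> = \<tau>"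
  shows "harmonic_quotient V E \<Lambda>"
proof -
  have "card {e \<in> E. P \<in> e \<and> quot_map_edge \<Lambda> e = Inr e'} = card {\<sigma> \<in> \<Lambda>. \<sigma> P = P}"
    if P: "P \<in> V" and e': "e' \<in> quot_edges E \<Lambda>" "vert_orbit \<Lambda> P \<in> quot_ends \<Lambda> e'" for P e'
  proof -
    have aut: "\<sigma> \<in> graph_auto V E" if "\<sigma> \<in> \<Lambda>" for \<sigma>
      using that GraphAut_subgroupD(1)[OF \<Lambda>] by blast
    obtain e0 where e0: "e0 \<in> E" "crossing \<Lambda> e0" "e' = edge_orbit \<Lambda> e0"
      using e'(1) by (auto simp: quot_edges_def)
    obtain \<rho> y where \<rho>: "\<rho> \<in> \<Lambda>" "y \<in> e0" "vert_orbit \<Lambda> P = vert_orbit \<Lambda> (\<rho> y)"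
      using e'(2) unfolding quot_ends_def e0(3) edge_orbit_def by blast
    obtain a b where "e0 = {a, b}" "a \<in> V" "b \<in> V"
      using simple_graph_edgeE[OF G e0(1)] by metis
    then obtain z where e0z: "e0 = {y, z}" "y \<in> V" "z \<in> V"
      using \<rho>(2) by (cases "y = a") (auto simp: insert_commute)
    \<comment> \<open>\<open>quot_ends\<close> only says that \<open>P\<close> shares its orbit with
      an end \<open>y\<close> of the representative \<open>e0\<close>. Moving \<open>y\<close> to
      \<open>P\<close> by some \<open>\<tau>\<close> yields a representative \<open>{P, Q}\<close>
      at \<open>P\<close> itself.\<close>
    have "P \<in> vert_orbit \<Lambda> y"
      using vert_orbit_refl[OF \<Lambda> P] \<rho>(3) vert_orbit_image[OF \<Lambda> \<rho>(1) e0z(2)] by simp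
    then obtain \<tau> where \<tau>: "\<tau> \<in> \<Lambda>" "P = \<tau> y"
      by (auto simp: vert_orbit_def)
    define Q where "Q = \<tau> z"
    have "{P, Q} \<in> E"
      using graph_autoD(4)[OF aut[OF \<tau>(1)], of y z] e0(1) e0z \<tau>(2) by (simp add: Q_def)
    note PQ = this simple_graph_edgeD[OF G this]
    have orb: "edge_orbit \<Lambda> {P, Q} = e'"
      using edge_orbit_image[OF \<Lambda> \<tau>(1), of e0] e0z e0(3) \<tau>(2) by (simp add: Q_def)
    have diff: "vert_orbit \<Lambda> P \<noteq> vert_orbit \<Lambda> Q"
      using e0(2) vert_orbit_image[OF \<Lambda> \<tau>(1)] e0z \<tau>(2) by (simp add: crossing_pair Q_def)
    have "bij_betw (\<lambda>\<sigma>. {P, \<sigma> Q}) {\<sigma> \<in> \<Lambda>. \<sigma> P = P}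
      {e \<in> E. P \<in> e \<and> quot_map_edge \<Lambda> e = Inr e'}"
      unfolding bij_betw_def
    proof
      show "inj_on (\<lambda>\<sigma>. {P, \<sigma> Q}) {\<sigma> \<in> \<Lambda>. \<sigma> P = P}"
      proof (rule inj_onI)
        fix \<sigma> \<tau> assume *: "\<sigma> \<in> {\<sigma> \<in> \<Lambda>. \<sigma> P = P}" "\<tau> \<in> {\<sigma> \<in> \<Lambda>. \<sigma> P = P}"
          and "{P, \<sigma> Q} = {P, \<tau> Q}"
        then have "\<sigma> Q = \<tau> Q"
          unfolding doubleton_eq_iff by metis
        then show "\<sigma> = \<tau>"
          using * by (intro free[OF _ _ PQ(1)]) simp_all
      qed
      show "(\<lambda>\<sigma>. {P, \<sigma> Q}) ` {\<sigma> \<in> \<Lambda>. \<sigma> P = P} = {e \<in> E. P \<in> e \<and> quot_map_edge \<Lambda> e = Inr e'}"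
      proof (intro equalityI subsetI)
        fix e assume "e \<in> (\<lambda>\<sigma>. {P, \<sigma> Q}) ` {\<sigma> \<in> \<Lambda>. \<sigma> P = P}"
        then obtain \<sigma> where \<sigma>: "\<sigma> \<in> \<Lambda>" "\<sigma> P = P" "e = {P, \<sigma> Q}"
          by blast
        have "e \<in> E"
          using graph_autoD(4)[OF aut[OF \<sigma>(1)], of P Q] PQ \<sigma> by simp
        moreover have "crossing \<Lambda> e"
          using diff vert_orbit_image[OF \<Lambda> \<sigma>(1) PQ(3)] by (simp add: \<sigma>(3) crossing_pair)
        moreover have "edge_orbit \<Lambda> e = e'"
          using edge_orbit_image[OF \<Lambda> \<sigma>(1), of "{P, Q}"] PQ \<sigma> orb by simp
        ultimately show "e \<in> {e \<in> E. P \<in> e \<and> quot_map_edge \<Lambda> e = Inr e'}"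
          using \<sigma>(3) by (simp add: quot_map_edge_eq_Inr)
      next
        fix e assume "e \<in> {e \<in> E. P \<in> e \<and> quot_map_edge \<Lambda> e = Inr e'}"
        then have e: "e \<in> E" "P \<in> e" "edge_orbit \<Lambda> e = e'"
          by (simp_all add: quot_map_edge_eq_Inr)
        then have "e \<in> edge_orbit \<Lambda> {P, Q}"
          using orb edge_orbit_refl[OF \<Lambda>, of e] G by (auto simp: simple_graph_def)
        then obtain \<sigma> where \<sigma>: "\<sigma> \<in> \<Lambda>" "e = {\<sigma> P, \<sigma> Q}"
          by (auto simp: edge_orbit_def)
        \<comment> \<open>The ends of a crossing edge lie in different orbits, so
          \<open>\<sigma>\<close> cannot interchange their roles.\<close>
        have "P \<noteq> \<sigma> Q"
          using diff vert_orbit_image[OF \<Lambda> \<sigma>(1) PQ(3)] by metis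
        then have "\<sigma> P = P"
          using e(2) \<sigma>(2) by auto
        then show "e \<in> (\<lambda>\<sigma>. {P, \<sigma> Q}) ` {\<sigma> \<in> \<Lambda>. \<sigma> P = P}"
          using \<sigma> by auto
      qed
    qed
    then show ?thesis
      by (simp add: bij_betw_same_card)
  qed
  then show ?thesis
    unfolding harmonic_quotient_def by simp
qed

text \<open>The hypothesis on edges is inherited by every subgroup, so the criterion for a single
  quotient covers all of them.\<close>

lemma acts_harmonicallyI:
  assumes "simple_graph V E" "subgroup H (GraphAut V E)"
    and "\<And>\<sigma> \<tau> x y. \<sigma> \<in> H \<Longrightarrow> \<tau> \<in> H \<Longrightarrow> {x, y} \<in> E \<Longrightarrow> \<sigma> x = \<tau> x \<Longrightarrow> \<sigma> y = \<tau> y \<Longrightarrow> \<sigma> = \<tau>"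
  shows "acts_harmonically V E H"
  unfolding acts_harmonically_def
proof (intro conjI allI impI assms(2))
  fix \<Lambda> assume \<Lambda>: "subgroup \<Lambda> (GraphAut V E) \<and> \<Lambda> \<subseteq> H"
  show "harmonic_quotient V E \<Lambda>"
    by (rule harmonic_quotientI[OF assms(1)]) (use \<Lambda> assms(3) in \<open>blast+\<close>)
qed


section \<open>Galois points force completeness\<close>

lemma aut_div_diff: "aut_div \<sigma> (F - F') = aut_div \<sigma> F - aut_div \<sigma> F'"
  by (simp add: aut_div_def frag_extend_diff)

lemma aut_div_frag_of [simp]: "aut_div \<sigma> (frag_of x) = frag_of (\<sigma> x)"
  by (simp add: aut_div_def)

lemma aut_div_sum_frag_of:
  assumes "finite A" "bij_betw \<sigma> A A"
  shows "aut_div \<sigma> (\<Sum>x\<in>A. frag_of x) = (\<Sum>x\<in>A. frag_of x)"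
proof -
  have "aut_div \<sigma> (\<Sum>x\<in>A. frag_of x) = (\<Sum>x\<in>A. frag_of (\<sigma> x))"
    using assms(1) by (simp add: aut_div_def frag_extend_sum o_def)
  also have "\<dots> = (\<Sum>x\<in>A. frag_of x)"
    by (rule sum.reindex_bij_betw[OF assms(2)])
  finally show ?thesis .
qed

text \<open>An automorphism maps the neighbours of \<open>x\<close> bijectively onto those of
  \<open>\<sigma> x\<close>, so it commutes with the Laplacian once \<open>f\<close> is transported
  along it. Asking for \<open>g\<close> only on \<open>V\<close> leaves the choice of an inverse of
  \<open>\<sigma>\<close> to the user.\<close>

lemma aut_div_laplacian:
  assumes G: "simple_graph V E" and \<sigma>: "\<sigma> \<in> graph_auto V E"
    and g: "\<And>x. x \<in> V \<Longrightarrow> g (\<sigma> x) = f x"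
  shows "aut_div \<sigma> (laplacian V E f) = laplacian V E g"
proof -
  have fin: "finite V" using G by (rule simple_graph_finite)
  note \<sigma>' = graph_autoD[OF \<sigma>]
  have nb: "(\<Sum>y\<in>{y. {x, y} \<in> E}. f x - f y) = (\<Sum>y\<in>{y. {\<sigma> x, y} \<in> E}. g (\<sigma> x) - g y)" if x: "x \<in> V" for x
  proof -
    have "bij_betw \<sigma> {y. {x, y} \<in> E} {y. {\<sigma> x, y} \<in> E}"
      unfolding bij_betw_def
    proof
      have inV: "y \<in> V" if "{z, y} \<in> E" for y z
        using simple_graph_edgeD(2)[OF G that] .
      show "inj_on \<sigma> {y. {x, y} \<in> E}"
        using \<sigma>'(1) inV by (auto simp: bij_betw_def intro: inj_on_subset)
      show "\<sigma> ` {y. {x, y} \<in> E} = {y. {\<sigma> x, y} \<in> E}"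
      proof (intro equalityI subsetI)
        fix y assume "y \<in> \<sigma> ` {y. {x, y} \<in> E}"
        then show "y \<in> {y. {\<sigma> x, y} \<in> E}"
          using \<sigma>'(4)[OF x inV] by auto
      next
        fix y assume y: "y \<in> {y. {\<sigma> x, y} \<in> E}"
        then have "y \<in> \<sigma> ` V"
          using inV[of "\<sigma> x" y] \<sigma>'(1) by (simp add: bij_betw_def)
        then show "y \<in> \<sigma> ` {y. {x, y} \<in> E}"
          using \<sigma>'(4)[OF x] y by auto
      qed
    qed
    from sum.reindex_bij_betw[OF this, of "\<lambda>y. g (\<sigma> x) - g y"] show ?thesis
      using g simple_graph_edgeD(2)[OF G] x by (auto intro!: sum.cong)
  qed
  have "aut_div \<sigma> (laplacian V E f)
    = (\<Sum>x\<in>V. frag_cmul (\<Sum>y\<in>{y. {x, y} \<in> E}. f x - f y) (frag_of (\<sigma> x)))"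
    using fin by (simp add: aut_div_def laplacian_def frag_extend_sum frag_extend_cmul o_def)
  also have "\<dots> = (\<Sum>x\<in>V. frag_cmul (\<Sum>y\<in>{y. {\<sigma> x, y} \<in> E}. g (\<sigma> x) - g y) (frag_of (\<sigma> x)))"
    by (intro sum.cong refl) (simp only: nb)
  also have "\<dots> = laplacian V E g"
    unfolding laplacian_def by (rule sum.reindex_bij_betw[OF \<sigma>'(1)])
  finally show ?thesis .
qed

text \<open>Applying \<open>\<sigma>\<close> to the equivalence of \<open>F\<close> with the sum
  minus \<open>P\<close> replaces only \<open>P\<close> by \<open>\<sigma> P\<close>. On subtracting
  the two equations \<open>F\<close> and the sum cancel, which leaves \<open>\<sigma> P\<close>
  equivalent to \<open>P\<close>.\<close>

lemma linear_system_invariant_fixes: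
  assumes G: "simple_graph V E" "two_edge_connected V E"
    and P: "P \<in> V" and \<sigma>: "\<sigma> \<in> graph_auto V E"
    and F: "F \<in> linear_system V E ((\<Sum>x\<in>V. frag_of x) - frag_of P)" "aut_div \<sigma> F = F"
  shows "\<sigma> P = P"
proof -
  let ?D = "\<Sum>x\<in>V. frag_of x"
  note \<sigma>' = graph_autoD[OF \<sigma>]
  obtain f where f: "F - (?D - frag_of P) = laplacian V E f"
    using F(1) by (auto simp: linear_system_def lin_equiv_def)
  define g where "g = f \<circ> inv_into V \<sigma>"
  have "g (\<sigma> x) = f x" if "x \<in> V" for x
    using that \<sigma>'(1) by (simp add: g_def bij_betw_def)
  then have "aut_div \<sigma> (F - (?D - frag_of P)) = laplacian V E g"
    unfolding f by (rule aut_div_laplacian[OF G(1) \<sigma>])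
  then have "F - (?D - frag_of (\<sigma> P)) = laplacian V E g"
    by (simp add: aut_div_diff F(2) aut_div_sum_frag_of[OF simple_graph_finite[OF G(1)] \<sigma>'(1)])
  then have "frag_of (\<sigma> P) - frag_of P = laplacian V E g - laplacian V E f"
    unfolding f[symmetric] by (simp add: algebra_simps)
  then show ?thesis
    unfolding laplacian_diff by (rule two_edge_connected_frag_of_eq[OF G \<sigma>'(3)[OF P]])
qed

section \<open>Orbits and adjacency at Galois points\<close>

lemma div_deg_sum_frag_of: "finite V \<Longrightarrow> div_deg V (\<Sum>x\<in>V. frag_of x) = int (card V)"
  by (simp add: div_deg_def lookup_sum sum.delta')

text \<open>The group of \<open>P\<close> fixes \<open>P\<close>, and an orbit of a neighbour \<open>w\<close> of \<open>P\<close> is regular because no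
  nontrivial element fixes both \<open>P\<close> and \<open>w\<close>; having \<open>card V - 1\<close> elements it is \<open>V - {P}\<close>.\<close>

lemma galois_point_transitive:
  assumes G: "simple_graph V E" and gal: "galois_point V E (\<Sum>x\<in>V. frag_of x) P"
  obtains w where "\<forall>x\<in>V - {P}. \<exists>\<sigma>\<in>graph_auto V E. \<sigma> P = P \<and> \<sigma> w = x"
    "{P, w} \<in> E"
proof -
  let ?D = "\<Sum>x\<in>V. frag_of x"
  have G2: "two_edge_connected V E" and P: "P \<in> V"
    using gal by (simp_all add: galois_point_def)
  have fin: "finite V" using G by (rule simple_graph_finite)
  obtain H F where H: "subgroup H (GraphAut V E)" "int (card H) = div_deg V ?D - 1"
      "acts_harmonically V E H"
    and F: "F \<in> linear_system V E (?D - frag_of P)" "\<forall>\<sigma>\<in>H. aut_div \<sigma> F = F"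
    using gal unfolding galois_point_def by blast
  have aut: "\<sigma> \<in> graph_auto V E" if "\<sigma> \<in> H" for \<sigma>
    using that GraphAut_subgroupD(1)[OF H(1)] by blast
  have fix_P: "\<sigma> P = P" if "\<sigma> \<in> H" for \<sigma>
    by (rule linear_system_invariant_fixes[OF G G2 P aut[OF that] F(1)]) (use F(2) that in blast)
  have conn: "connected_graph V E" and "2 \<le> card V"
    using G2 by (simp_all add: two_edge_connected_def)
  then have "{P} \<noteq> V"
    by auto
  then obtain w where w: "{P, w} \<in> E"
    using connected_graph_crossing_edge[OF conn, of "{P}"] P by auto
  note inV = simple_graph_edgeD[OF G w]
  have "inj_on (\<lambda>\<sigma>. \<sigma> w) H"
  proof (rule inj_onI)
    fix \<sigma> \<tau> assume *: "\<sigma> \<in> H" "\<tau> \<in> H" "\<sigma> w = \<tau> w"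
    show "\<sigma> = \<tau>"
      by (rule acts_harmonically_eq_on_edge[OF G conn H(3) *(1,2) _ *(3) w]) (simp only: fix_P[OF *(1)] fix_P[OF *(2)])
  qed
  moreover have "(\<lambda>\<sigma>. \<sigma> w) ` H \<subseteq> V - {P}"
  proof (rule image_subsetI)
    fix \<sigma> assume \<sigma>: "\<sigma> \<in> H"
    have "{P, \<sigma> w} \<in> E"
      using graph_autoD(4)[OF aut[OF \<sigma>] inV(1,2)] w fix_P[OF \<sigma>] by simp
    then show "\<sigma> w \<in> V - {P}"
      using simple_graph_edgeD[OF G, of P "\<sigma> w"] by simp
  qed
  moreover have "card H = card (V - {P})"
    using H(2) P fin \<open>2 \<le> card V\<close> by (simp add: div_deg_sum_frag_of)
  ultimately have orbit: "(\<lambda>\<sigma>. \<sigma> w) ` H = V - {P}"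
    using fin by (intro card_subset_eq) (simp_all add: card_image)
  have "\<exists>\<sigma>\<in>graph_auto V E. \<sigma> P = P \<and> \<sigma> w = x" if "x \<in> V - {P}" for x
  proof -
    have "x \<in> (\<lambda>\<sigma>. \<sigma> w) ` H"
      using that orbit by simp
    then obtain \<sigma> where "\<sigma> \<in> H" "x = \<sigma> w"
      by blast
    then show ?thesis
      using aut[OF \<open>\<sigma> \<in> H\<close>] fix_P[OF \<open>\<sigma> \<in> H\<close>] by blast
  qed
  then show thesis
    using that w by blast
qed

text \<open>An automorphism fixing \<open>P\<close> and taking the neighbour \<open>w\<close> to
  \<open>x\<close> carries the edge \<open>{P, w}\<close> to \<open>{P, x}\<close>.\<close>

lemma galois_point_adjacent:
  assumes G: "simple_graph V E" and gal: "galois_point V E (\<Sum>x\<in>V. frag_of x) P"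
    and x: "x \<in> V" "x \<noteq> P"
  shows "{P, x} \<in> E"
proof -
  obtain w where w: "\<forall>x\<in>V - {P}. \<exists>\<sigma>\<in>graph_auto V E. \<sigma> P = P \<and> \<sigma> w = x"
    "{P, w} \<in> E"
    by (rule galois_point_transitive[OF G gal])
  obtain \<sigma> where \<sigma>: "\<sigma> \<in> graph_auto V E" "\<sigma> P = P" "\<sigma> w = x"
    using bspec[OF w(1), of x] x by auto
  show ?thesis
    using graph_autoD(4)[OF \<sigma>(1) simple_graph_edgeD(1,2)[OF G w(2)]] w(2) \<sigma> by simp
qed

text \<open>As \<open>Q \<noteq> P\<close>, some automorphism takes \<open>w\<close> to
  \<open>Q\<close>, which is adjacent to all other vertices; hence so is \<open>w\<close>.
  Automorphisms take \<open>w\<close> to every vertex except \<open>P\<close>, so these are adjacent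
  to all others too, and \<open>P\<close> is so as a Galois point.\<close>

lemma two_galois_points_complete:
  assumes G: "simple_graph V E"
    and gal: "galois_point V E (\<Sum>x\<in>V. frag_of x) P" "galois_point V E (\<Sum>x\<in>V. frag_of x) Q"
    and PQ: "P \<noteq> Q"
  shows "complete_graph V E"
proof -
  have inV: "P \<in> V" "Q \<in> V"
    using gal by (simp_all add: galois_point_def)
  obtain w where w: "\<forall>x\<in>V - {P}. \<exists>\<sigma>\<in>graph_auto V E. \<sigma> P = P \<and> \<sigma> w = x"
    "{P, w} \<in> E"
    by (rule galois_point_transitive[OF G gal(1)])
  have wV: "w \<in> V"
    using simple_graph_edgeD(2)[OF G w(2)] .
  have star: "{w, y} \<in> E" if y: "y \<in> V" "y \<noteq> w" for y
  proof -
    obtain \<sigma> where \<sigma>: "\<sigma> \<in> graph_auto V E" "\<sigma> w = Q"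
      using bspec[OF w(1), of Q] inV(2) PQ by auto
    have "inj_on \<sigma> V"
      using graph_autoD(1)[OF \<sigma>(1)] by (simp add: bij_betw_def)
    then have "\<sigma> y \<noteq> Q"
      using inj_on_eq_iff[of \<sigma> V y w] \<sigma>(2) y wV by simp
    then have "{\<sigma> w, \<sigma> y} \<in> E"
      unfolding \<sigma>(2) by (rule galois_point_adjacent[OF G gal(2) graph_autoD(3)[OF \<sigma>(1) y(1)]])
    then show ?thesis
      using graph_autoD(4)[OF \<sigma>(1) wV y(1)] by simp
  qed
  have "{x, y} \<in> E" if xy: "x \<in> V" "y \<in> V" "x \<noteq> y" for x y
  proof (cases "x = P")
    case True
    then show ?thesis
      using galois_point_adjacent[OF G gal(1) xy(2)] xy(3) by blast
  next
    case False
    then have "x \<in> V - {P}"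
      using xy(1) by simp
    then obtain \<sigma> where \<sigma>: "\<sigma> \<in> graph_auto V E" "\<sigma> w = x"
      using w(1) by blast
    have "\<sigma> ` V = V"
      using graph_autoD(1)[OF \<sigma>(1)] by (simp add: bij_betw_def)
    then have "y \<in> \<sigma> ` V"
      using xy(2) by simp
    then obtain z where z: "z \<in> V" "\<sigma> z = y"
      by (metis imageE)
    have "z \<noteq> w"
      using \<sigma>(2) z(2) xy(3) by metis
    then have "{w, z} \<in> E"
      by (rule star[OF z(1)])
    then show ?thesis
      using graph_autoD(4)[OF \<sigma>(1) wV z(1)] \<sigma>(2) z(2) by simp
  qed
  then have "e \<in> E" if "e \<subseteq> V" "card e = 2" for e
    using that by (metis card_2_iff insert_subset)
  then show ?thesis
    using G unfolding complete_graph_def simple_graph_def by blast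
qed


section \<open>Complete graphs\<close>

lemma complete_graph_edge_iff:
  "complete_graph V E \<Longrightarrow> {x, y} \<in> E \<longleftrightarrow> x \<in> V \<and> y \<in> V \<and> x \<noteq> y"
  by (auto simp: complete_graph_def card_insert_if)

lemma complete_graph_neighbours:
  "complete_graph V E \<Longrightarrow> x \<in> V \<Longrightarrow> {y. {x, y} \<in> E} = V - {x}"
  by (auto simp: complete_graph_edge_iff)

text \<open>Adjacency of vertices is inequality here, which bijections preserve in both
  directions.\<close>

lemma graph_auto_complete_graph:
  assumes "complete_graph V E"
  shows "graph_auto V E = Bij V"
proof -
  have "{x, y} \<in> E \<longleftrightarrow> {\<sigma> x, \<sigma> y} \<in> E" if "\<sigma> \<in> Bij V" "x \<in> V" "y \<in> V" for \<sigma> x y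
    using that by (auto simp: complete_graph_edge_iff[OF assms] Bij_def bij_betw_def inj_on_eq_iff)
  then show ?thesis
    by (auto simp: graph_auto_def)
qed

text \<open>The group is generated by a cyclic permutation of \<open>V - {P}\<close>.\<close>

lemma complete_graph_regular_group:
  assumes K: "complete_graph V E" and fin: "finite V" and P: "P \<in> V" and n: "2 \<le> card V"
  obtains H where "subgroup H (GraphAut V E)" "card H = card V - 1" "\<forall>\<sigma>\<in>H. \<sigma> P = P"
    "\<forall>\<sigma>\<in>H. \<forall>\<tau>\<in>H. \<forall>x\<in>V - {P}. \<sigma> x = \<tau> x \<longrightarrow> \<sigma> = \<tau>"
proof -
  define m where "m = card V - 1"
  have m: "m > 0" using n by (simp add: m_def)
  have "card {..<m} = card (V - {P})"
    using fin P by (simp add: m_def)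
  then obtain g where g: "bij_betw g {..<m} (V - {P})"
    using finite_same_card_bij[of "{..<m}" "V - {P}"] fin by blast
  define h where "h = inv_into {..<m} g"
  have gV: "g i \<in> V - {P}" if "i < m" for i
    using bij_betwE[OF g] that by blast
  have hg: "h (g i) = i" if "i < m" for i
    using g that by (simp add: h_def bij_betw_def)
  have g_surj: "\<exists>i<m. x = g i" if "x \<in> V - {P}" for x
  proof -
    have "x \<in> g ` {..<m}"
      using g that by (simp add: bij_betw_def)
    then show ?thesis by blast
  qed
  have g_inj: "i = j" if "g i = g j" "i < m" "j < m" for i j
    using hg[OF that(2)] hg[OF that(3)] that(1) by metis
  \<comment> \<open>\<open>rot k\<close> shifts the numbering \<open>g\<close> of
    \<open>V - {P}\<close> by \<open>k\<close> modulo \<open>m\<close>. The case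
    \<open>x = P\<close> is separate because \<open>h\<close> inverts \<open>g\<close> only on
    \<open>V - {P}\<close>; the restriction makes the function extensional, as \<open>Bij V\<close>
    requires.\<close>
  define rot where "rot k = (\<lambda>x\<in>V. if x = P then P else g ((h x + k) mod m))" for k
  have rot_P: "rot k P = P" for k
    using P by (simp add: rot_def)
  have rot_g: "rot k (g i) = g ((i + k) mod m)" if "i < m" for k i
    using gV[OF that] hg[OF that] by (simp add: rot_def)
  have rot_V: "rot k x \<in> V" if "x \<in> V" for k x
    using that P gV[of "(h x + k) mod m"] m by (simp add: rot_def)
  have rot_rot: "rot k (rot l x) = rot (l + k) x" if x: "x \<in> V" for k l x
  proof (cases "x = P")
    case False
    then obtain i where i: "i < m" "x = g i"
      using g_surj x by blast
    have "rot k (g ((i + l) mod m)) = g (((i + l) mod m + k) mod m)"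
      using m by (intro rot_g) simp
    then show ?thesis
      using i by (simp add: rot_g mod_add_left_eq add.assoc)
  qed (simp add: rot_P)
  have rot_mod: "rot k = rot (k mod m)" for k
    unfolding rot_def mod_add_right_eq by (rule refl)
  have rot_0: "rot 0 x = x" if x: "x \<in> V" for x
  proof (cases "x = P")
    case False
    then obtain i where "i < m" "x = g i"
      using g_surj x by blast
    then show ?thesis
      using rot_g[of i 0] by simp
  qed (simp add: rot_P)
  \<comment> \<open>The factor \<open>m - 1\<close> plays the part of -1 modulo \<open>m\<close>, so
    shifts remain natural numbers.\<close>
  have rot_inv: "rot ((m - 1) * k) (rot k x) = x" if x: "x \<in> V" for k x
  proof -
    have "k + (m - 1) * k = m * k"
      using m by (cases m) simp_all
    then have "rot ((m - 1) * k) (rot k x) = rot (m * k) x"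
      using rot_rot[OF x] by simp
    also have "\<dots> = x"
      using rot_mod[of "m * k"] rot_0[OF x] by simp
    finally show ?thesis .
  qed
  have rot_Bij: "rot k \<in> Bij V" for k
  proof -
    have "inj_on (rot k) V"
      using rot_inv by (rule inj_on_inverseI)
    moreover from this have "rot k ` V = V"
      using fin rot_V by (intro endo_inj_surj) auto
    ultimately show ?thesis
      by (simp add: Bij_def bij_betw_def rot_def)
  qed
  have rot_free: "rot k = rot l" if eq: "rot k x = rot l x" and x: "x \<in> V - {P}" for k l x
  proof -
    obtain i where i: "i < m" "x = g i"
      using g_surj[OF x] by blast
    then have "g ((i + k) mod m) = g ((i + l) mod m)"
      using eq by (simp add: rot_g)
    then have "(i + k) mod m = (i + l) mod m"
      by (rule g_inj) (use m in simp_all)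
    then have "k mod m = l mod m"
      unfolding nat_mod_eq_iff by (simp add: add.assoc)
    then show ?thesis
      using rot_mod[of k] rot_mod[of l] by simp
  qed
  have "range rot = rot ` {..<m}"
  proof
    show "range rot \<subseteq> rot ` {..<m}"
    proof (rule image_subsetI)
      fix k show "rot k \<in> rot ` {..<m}"
        using rot_mod[of k] m by (intro image_eqI[of _ _ "k mod m"]) simp_all
    qed
  qed auto
  \<comment> \<open>Evaluation at \<open>g 0\<close> recovers the shift, so the residues below
    \<open>m\<close> give \<open>m\<close> different elements.\<close>
  moreover have "inj_on rot {..<m}"
  proof (rule inj_onI)
    fix k l assume kl: "k \<in> {..<m}" "l \<in> {..<m}" "rot k = rot l"
    then have "g k = g l"
      using rot_g[OF m, of k] rot_g[OF m, of l] by simp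
    then show "k = l"
      using g_inj kl by simp
  qed
  ultimately have "card (range rot) = m"
    by (simp add: card_image)
  moreover have "subgroup (range rot) (GraphAut V E)"
  proof (rule GraphAut_subgroupI)
    show "range rot \<subseteq> graph_auto V E"
      using rot_Bij by (auto simp: graph_auto_complete_graph[OF K])
    have "rot 0 = (\<lambda>x\<in>V. x)"
    proof (rule extensionalityI)
      show "rot 0 \<in> extensional V"
        by (simp add: rot_def)
    qed (simp_all add: rot_0)
    then show "(\<lambda>x\<in>V. x) \<in> range rot"
      by (metis rangeI)
    show "compose V \<sigma> \<tau> \<in> range rot" if "\<sigma> \<in> range rot" "\<tau> \<in> range rot" for \<sigma> \<tau>
    proof -
      obtain k l where "\<sigma> = rot k" "\<tau> = rot l"
        using \<open>\<sigma> \<in> range rot\<close> \<open>\<tau> \<in> range rot\<close> by auto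
      moreover have "compose V (rot k) (rot l) = rot (l + k)"
      proof (rule extensionalityI)
        show "rot (l + k) \<in> extensional V"
          by (simp add: rot_def)
        show "compose V (rot k) (rot l) x = rot (l + k) x" if "x \<in> V" for x
          using that rot_rot by (simp add: compose_eq)
      qed simp
      ultimately show ?thesis by simp
    qed
    show "\<exists>\<tau>\<in>range rot. \<forall>x\<in>V. \<tau> (\<sigma> x) = x" if "\<sigma> \<in> range rot" for \<sigma>
    proof -
      obtain k where "\<sigma> = rot k"
        using \<open>\<sigma> \<in> range rot\<close> by (elim rangeE)
      then have "\<forall>x\<in>V. rot ((m - 1) * k) (\<sigma> x) = x"
        using rot_inv by simp
      then show ?thesis
        by blast
    qed
  qed
  moreover have "\<forall>\<sigma>\<in>range rot. \<sigma> P = P"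
    by (simp add: rot_P)
  moreover have "\<forall>\<sigma>\<in>range rot. \<forall>\<tau>\<in>range rot. \<forall>x\<in>V - {P}. \<sigma> x = \<tau> x \<longrightarrow> \<sigma> = \<tau>"
  proof (intro ballI impI)
    fix \<sigma> \<tau> x assume "\<sigma> \<in> range rot" "\<tau> \<in> range rot" and x: "x \<in> V - {P}" "\<sigma> x = \<tau> x"
    then obtain k l where "\<sigma> = rot k" "\<tau> = rot l"
      by (elim rangeE)
    then show "\<sigma> = \<tau>"
      using rot_free[of k x l] x by simp
  qed
  ultimately show thesis
    unfolding m_def by (intro that)
qed

section \<open>Effectivity and ranks on a complete graph\<close>

text \<open>For \<open>P \<noteq> Q\<close> the divisor is already effective. For
  \<open>P = Q\<close> the only deficit is -1 at \<open>P\<close>; with the indicator function of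
  \<open>P\<close>, every other vertex gives its single chip to \<open>P\<close>, which ends with
  \<open>card V - 2\<close> chips.\<close>

lemma complete_graph_linear_system_nonempty:
  assumes K: "complete_graph V E" and fin: "finite V" and n: "2 \<le> card V"
    and PQ: "P \<in> V" "Q \<in> V"
  shows "linear_system V E ((\<Sum>x\<in>V. frag_of x) - frag_of P - frag_of Q) \<noteq> {}"
proof -
  let ?D = "(\<Sum>x\<in>V. frag_of x) - frag_of P - frag_of Q"
  have D: "?D \<in> Divs V"
    using PQ by (intro Divs_diff Divs_frag_of sum_closed_free_Abelian_group)
  have lookup_D: "Poly_Mapping.lookup ?D x = 1 - (if x = P then 1 else 0) - (if x = Q then 1 else 0)"
    if "x \<in> V" for x
    using that fin by (simp add: lookup_minus lookup_sum)
  define f :: "'a \<Rightarrow> int" where "f x = (if x = P \<and> P = Q then 1 else 0)" for x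
  have "0 \<le> Poly_Mapping.lookup ?D x + (\<Sum>y\<in>{y. {x, y} \<in> E}. f x - f y)" if x: "x \<in> V" for x
  proof (cases "P = Q")
    case False
    then show ?thesis
      using lookup_D[OF x] by (simp add: f_def)
  next
    case True
    have nb: "{y. {x, y} \<in> E} = V - {x}"
      using complete_graph_neighbours[OF K x] .
    show ?thesis
    proof (cases "x = P")
      case True
      then have "(\<Sum>y\<in>{y. {x, y} \<in> E}. f x - f y) = (\<Sum>y\<in>V - {x}. 1)"
        unfolding nb using \<open>P = Q\<close> by (intro sum.cong) (auto simp: f_def)
      also have "\<dots> = int (card V) - 1"
        using x fin n by (simp add: of_nat_diff)
      finally show ?thesis
        using lookup_D[OF x] True \<open>P = Q\<close> n by simp
    next
      case False
      then have "(\<Sum>y\<in>{y. {x, y} \<in> E}. f x - f y) = (\<Sum>y\<in>V - {x}. if y = P then -1 else 0)"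
        unfolding nb using \<open>P = Q\<close> by (intro sum.cong) (auto simp: f_def)
      also have "\<dots> = -1"
        using False fin PQ by simp
      finally show ?thesis
        using lookup_D[OF x] False \<open>P = Q\<close> by simp
    qed
  qed
  then show ?thesis
    unfolding linear_system_nonempty_iff[OF fin D] by blast
qed

text \<open>The minimum of a function witnessing effectivity would be attained neither at \<open>P\<close> nor,
  consequently, at \<open>Q\<close>; elsewhere the divisor has one chip but at least two must leave.\<close>

lemma complete_graph_linear_system_empty:
  assumes K: "complete_graph V E" and fin: "finite V"
    and PQ: "P \<in> V" "Q \<in> V" "P \<noteq> Q"
  shows "linear_system V E ((\<Sum>x\<in>V. frag_of x) - frag_of P - frag_of P - frag_of Q) = {}"
proof (rule ccontr)
  let ?D = "(\<Sum>x\<in>V. frag_of x) - frag_of P - frag_of P - frag_of Q"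
  have D: "?D \<in> Divs V"
    using PQ by (intro Divs_diff Divs_frag_of sum_closed_free_Abelian_group)
  have lookup_D: "Poly_Mapping.lookup ?D x = 1 - (if x = P then 2 else 0) - (if x = Q then 1 else 0)"
    if "x \<in> V" for x
    using that fin by (simp add: lookup_minus lookup_sum)
  assume "linear_system V E ?D \<noteq> {}"
  then obtain f where f: "\<And>x. x \<in> V \<Longrightarrow> 0 \<le> Poly_Mapping.lookup ?D x + (\<Sum>y\<in>{y. {x, y} \<in> E}. f x - f y)"
    unfolding linear_system_nonempty_iff[OF fin D] by blast
  have eff: "0 \<le> 1 - (if x = P then 2 else 0) - (if x = Q then 1 else 0) + (\<Sum>y\<in>V - {x}. f x - f y)"
    if "x \<in> V" for x
    using f[OF that] lookup_D[OF that] complete_graph_neighbours[OF K that] by simp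
  obtain a where a: "a \<in> V" "\<forall>y\<in>V. f a \<le> f y"
    using ex_is_arg_min_if_finite[OF fin, of f] PQ(1) by (auto simp: is_arg_min_linorder)
  \<comment> \<open>At a minimum no term \<open>f x - f y\<close> is positive, so discarding terms
    can only increase the sum. The set \<open>B\<close> collects the vertices already known to lie
    strictly above the minimum; each contributes at most -1.\<close>
  have bound: "(\<Sum>y\<in>V - {x}. f x - f y) \<le> (\<Sum>y\<in>B. f x - f y)"
    if "x \<in> V" "f x = f a" "B \<subseteq> V - {x}" for x B
  proof -
    have "(\<Sum>y\<in>B. f y - f x) \<le> (\<Sum>y\<in>V - {x}. f y - f x)"
      using that a fin by (intro sum_mono2) auto
    then show ?thesis
      by (simp add: sum_subtractf)
  qed
  have P: "f P > f a"
  proof (rule ccontr)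
    assume "\<not> f P > f a"
    then have "f P = f a" using a PQ by force
    then show False
      using eff[OF PQ(1)] bound[OF PQ(1), of "{}"] PQ(3) by simp
  qed
  have Q: "f Q > f a"
  proof (rule ccontr)
    assume "\<not> f Q > f a"
    then have "f Q = f a" using a PQ by force
    then show False
      using eff[OF PQ(2)] bound[OF PQ(2), of "{P}"] PQ P by simp
  qed
  have "a \<noteq> P" "a \<noteq> Q"
    using P Q by auto
  then show False
    using eff[OF a(1)] bound[OF a(1), of "{P, Q}"] PQ P Q by simp
qed

text \<open>Any two chips can be removed from \<open>D\<close>, but not two at one vertex and a
  third at another. The three divisors arise from \<open>D\<close> by 0, 1 and 2 removals, which
  leaves 2, 1 and 0 for the rank.\<close>

lemma complete_graph_ranks:
  assumes K: "complete_graph V E" and fin: "finite V" and n: "2 \<le> card V"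
  defines "D \<equiv> \<Sum>x\<in>V. frag_of x"
  shows "div_rank V E D = 2"
    and "P \<in> V \<Longrightarrow> div_rank V E (D - frag_of P) = 1"
    and "P \<in> V \<Longrightarrow> Q \<in> V \<Longrightarrow> div_rank V E (D - frag_of P - frag_of Q) = 0"
proof -
  have ne: "V \<noteq> {}" using n by auto
  have D: "D \<in> Divs V"
    unfolding D_def by (intro sum_closed_free_Abelian_group Divs_frag_of)
  note nonempty = complete_graph_linear_system_nonempty[OF K fin n, folded D_def]
  note empty = complete_graph_linear_system_empty[OF K fin, folded D_def]
  note simps = rank_at_least_Suc[OF fin] rank_at_least_0[OF fin]
  have other: "\<exists>y\<in>V. y \<noteq> x" for x
  proof (rule ccontr)
    assume "\<not> ?thesis"
    then have "V \<subseteq> {x}" by blast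
    then have "card V \<le> card {x}" by (intro card_mono) simp_all
    with n show False by simp
  qed
  obtain p q where pq: "p \<in> V" "q \<in> V" "p \<noteq> q"
    using ne other by blast
  have "div_rank V E D = int (Suc (Suc 0))"
  proof (rule div_rank_eqI[OF fin ne D])
    show "rank_at_least V E (Suc (Suc 0)) D"
      unfolding simps using nonempty by blast
    show "\<not> rank_at_least V E (Suc (Suc (Suc 0))) D"
      unfolding simps using empty[OF pq] pq by blast
  qed
  then show "div_rank V E D = 2" by simp
  show "div_rank V E (D - frag_of P) = 1" if P: "P \<in> V"
  proof -
    obtain y where "y \<in> V" "P \<noteq> y" using other by metis
    then have "\<not> rank_at_least V E (Suc (Suc 0)) (D - frag_of P)"
      unfolding simps using empty[OF P] P by blast
    moreover have "rank_at_least V E (Suc 0) (D - frag_of P)"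
      unfolding simps using nonempty[OF P] by blast
    ultimately have "div_rank V E (D - frag_of P) = int (Suc 0)"
      by (intro div_rank_eqI[OF fin ne Divs_diff[OF D Divs_frag_of[OF P]]])
    then show ?thesis by simp
  qed
  show "div_rank V E (D - frag_of P - frag_of Q) = 0" if P: "P \<in> V" and Q: "Q \<in> V"
  proof -
    \<comment> \<open>The third vertex has to produce exactly one repetition: any other vertex if
      \<open>P = Q\<close>, and \<open>P\<close> again otherwise.\<close>
    have "\<exists>y\<in>V. linear_system V E (D - frag_of P - frag_of Q - frag_of y) = {}"
    proof (cases "P = Q")
      case True
      obtain y where "y \<in> V" "P \<noteq> y" using other by metis
      then show ?thesis
        using empty[OF P] True by blast
    next
      case False
      then have "linear_system V E (D - frag_of P - frag_of Q - frag_of P) = {}"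
        using empty[OF P Q] by (simp add: algebra_simps)
      then show ?thesis using P by blast
    qed
    then have "\<not> rank_at_least V E (Suc 0) (D - frag_of P - frag_of Q)"
      unfolding simps by blast
    moreover have "rank_at_least V E 0 (D - frag_of P - frag_of Q)"
      unfolding simps by (rule nonempty[OF P Q])
    ultimately have "div_rank V E (D - frag_of P - frag_of Q) = int 0"
      by (intro div_rank_eqI[OF fin ne Divs_diff[OF Divs_diff[OF D Divs_frag_of[OF P]] Divs_frag_of[OF Q]]])
    then show ?thesis by simp
  qed
qed

section \<open>Galois points of a complete graph\<close>

lemma complete_graph_galois_point:
  assumes G: "simple_graph V E" "two_edge_connected V E" and K: "complete_graph V E"
    and P: "P \<in> V"
  shows "galois_point V E (\<Sum>x\<in>V. frag_of x) P"
proof -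
  define D :: "'a \<Rightarrow>\<^sub>0 int" where "D = (\<Sum>x\<in>V. frag_of x)"
  have fin: "finite V" using G(1) by (rule simple_graph_finite)
  have n: "2 \<le> card V" using G(2) by (simp add: two_edge_connected_def)
  have D: "D \<in> Divs V"
    unfolding D_def by (intro sum_closed_free_Abelian_group Divs_frag_of)
  note ranks = complete_graph_ranks[OF K fin n, folded D_def]
  obtain H where H: "subgroup H (GraphAut V E)" "card H = card V - 1" "\<forall>\<sigma>\<in>H. \<sigma> P = P"
    and free: "\<forall>\<sigma>\<in>H. \<forall>\<tau>\<in>H. \<forall>x\<in>V - {P}. \<sigma> x = \<tau> x \<longrightarrow> \<sigma> = \<tau>"
    by (rule complete_graph_regular_group[OF K fin P n])
  have harm: "acts_harmonically V E H"
  proof (rule acts_harmonicallyI[OF G(1) H(1)])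
    fix \<sigma> \<tau> x y assume *: "\<sigma> \<in> H" "\<tau> \<in> H" "{x, y} \<in> E" "\<sigma> x = \<tau> x" "\<sigma> y = \<tau> y"
    \<comment> \<open>One end of the edge differs from \<open>P\<close>, and agreement at that end
      already determines the group element.\<close>
    then have "x \<in> V - {P} \<or> y \<in> V - {P}"
      using simple_graph_edgeD[OF G(1) *(3)] by auto
    then show "\<sigma> = \<tau>"
      using free * by metis
  qed
  define E1 :: "'a \<Rightarrow>\<^sub>0 int" where "E1 = D - frag_of P"
  define E2 :: "'a \<Rightarrow>\<^sub>0 int" where "E2 = frag_cmul (int (card V) - 1) (frag_of P)"
  have lookup_E1: "Poly_Mapping.lookup E1 x = (if x \<in> V \<and> x \<noteq> P then 1 else 0)" for x
    using fin P by (auto simp: E1_def D_def lookup_minus lookup_sum)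
  have lookup_E2: "Poly_Mapping.lookup E2 x = (if x = P then int (card V) - 1 else 0)" for x
    by (simp add: E2_def)
  have E1: "E1 \<in> linear_system V E (D - frag_of P)"
  proof -
    have "E1 - (D - frag_of P) = laplacian V E (\<lambda>_. 0)"
      by (simp add: E1_def laplacian_def)
    moreover have "E1 \<in> Divs V"
      unfolding E1_def by (rule Divs_diff[OF D Divs_frag_of[OF P]])
    ultimately show ?thesis
      unfolding linear_system_def lin_equiv_def by (auto simp: effective_def lookup_E1)
  qed
  have E2: "E2 \<in> linear_system V E (D - frag_of P)"
  proof -
    \<comment> \<open>The Laplacian of the indicator of \<open>P\<close> adds
      \<open>card V - 1\<close> at \<open>P\<close> and takes one chip from each other vertex, which
      turns \<open>E1\<close> into \<open>E2\<close>.\<close>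
    define f :: "'a \<Rightarrow> int" where "f x = (if x = P then 1 else 0)" for x
    have "Poly_Mapping.lookup (E2 - E1) x = Poly_Mapping.lookup (laplacian V E f) x" for x
    proof (cases "x \<in> V")
      case x: True
      have nb: "{y. {x, y} \<in> E} = V - {x}"
        using complete_graph_neighbours[OF K x] .
      show ?thesis
      proof (cases "x = P")
        case True
        have "(\<Sum>y\<in>V - {P}. f P - f y) = (\<Sum>y\<in>V - {P}. 1)"
          by (intro sum.cong) (auto simp: f_def)
        then show ?thesis
          using True x fin n nb
          by (simp add: lookup_minus lookup_E1 lookup_E2 lookup_laplacian of_nat_diff)
      next
        case False
        then have "(\<Sum>y\<in>V - {x}. f x - f y) = (\<Sum>y\<in>V - {x}. if y = P then -1 else 0)"
          by (intro sum.cong) (auto simp: f_def)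
        then show ?thesis
          using False x fin P nb
          by (simp add: lookup_minus lookup_E1 lookup_E2 lookup_laplacian)
      qed
    next
      case False
      then show ?thesis
        using fin P by (auto simp: lookup_minus lookup_E1 lookup_E2 lookup_laplacian)
    qed
    then have "E2 - E1 = laplacian V E f"
      by (rule poly_mapping_eqI)
    then have "lin_equiv V E E2 (D - frag_of P)"
      unfolding lin_equiv_def E1_def by blast
    moreover have "E2 \<in> Divs V"
      using P by (auto simp: in_keys_iff lookup_E2 split: if_splits)
    moreover have "effective E2"
      using n by (simp add: effective_def lookup_E2)
    ultimately show ?thesis
      by (simp add: linear_system_def)
  qed
  have "Poly_Mapping.lookup E1 P \<noteq> Poly_Mapping.lookup E2 P"
    using n by (simp add: lookup_E1 lookup_E2)
  then have "E1 \<noteq> E2"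
    by metis
  have inv: "aut_div \<sigma> E1 = E1 \<and> aut_div \<sigma> E2 = E2" if \<sigma>: "\<sigma> \<in> H" for \<sigma>
  proof -
    have "\<sigma> \<in> graph_auto V E"
      using \<sigma> GraphAut_subgroupD(1)[OF H(1)] by blast
    then have "aut_div \<sigma> D = D"
      unfolding D_def by (intro aut_div_sum_frag_of[OF fin] graph_autoD(1))
    moreover have "\<sigma> P = P"
      using H(3) \<sigma> by blast
    ultimately show ?thesis
      by (simp add: E1_def E2_def aut_div_diff) (simp add: aut_div_def frag_extend_cmul)
  qed
  have "card (quot_verts V H) > 1"
  proof -
    \<comment> \<open>\<open>P\<close> forms an orbit by itself, so any second vertex provides a
      second orbit.\<close>
    have "{P} \<noteq> V" using n by auto
    then obtain Q where Q: "Q \<in> V" "Q \<noteq> P" using P by blast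
    have "vert_orbit H P \<subseteq> {P}"
      using H(3) by (auto simp: vert_orbit_def)
    then have "vert_orbit H P \<noteq> vert_orbit H Q"
      using vert_orbit_refl[OF H(1) Q(1)] Q(2) by blast
    then have "card {vert_orbit H P, vert_orbit H Q} = 2"
      by simp
    moreover have "card {vert_orbit H P, vert_orbit H Q} \<le> card (quot_verts V H)"
      using P Q(1) fin by (intro card_mono) (auto simp: quot_verts_def)
    ultimately show ?thesis by simp
  qed
  moreover have "int (card H) = div_deg V D - 1"
    using H(2) n fin by (simp add: D_def div_deg_sum_frag_of of_nat_diff)
  ultimately have "\<exists>H E1 E2. subgroup H (GraphAut V E) \<and>
        int (card H) = div_deg V D - 1 \<and>
        E1 \<in> linear_system V E (D - frag_of P) \<and>
        E2 \<in> linear_system V E (D - frag_of P) \<and>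
        E1 \<noteq> E2 \<and>
        card (quot_verts V H) > 1 \<and>
        acts_harmonically V E H \<and>
        (\<forall>\<sigma>\<in>H. aut_div \<sigma> E1 = E1 \<and> aut_div \<sigma> E2 = E2)"
    using H(1) E1 E2 \<open>E1 \<noteq> E2\<close> harm inv
    by (intro exI[of _ H] exI[of _ E1] exI[of _ E2] conjI ballI) simp_all
  then have "galois_point V E D P"
    unfolding galois_point_def using G(2) D ranks P by blast
  then show ?thesis
    by (simp add: D_def)
qed

theorem theorem1p3:
  fixes V :: "'a set" and E :: "'a set set" and D :: "'a \<Rightarrow>\<^sub>0 int"
  assumes "simple_graph V E"
    and "two_edge_connected V E"
    and "D = (\<Sum>P\<in>V. frag_of P)"
  shows "(complete_graph V E \<longleftrightarrow>
            div_rank V E D = 2 \<and>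
            (\<exists>P\<in>V. \<exists>Q\<in>V. P \<noteq> Q \<and> galois_point V E D P \<and> galois_point V E D Q)) \<and>
         (complete_graph V E \<longrightarrow> (\<forall>P\<in>V. galois_point V E D P))"
proof -
  have all: "galois_point V E D P" if "complete_graph V E" "P \<in> V" for P
    unfolding assms(3) by (rule complete_graph_galois_point[OF assms(1,2) that])
  have "\<exists>P\<in>V. \<exists>Q\<in>V. P \<noteq> Q"
    using assms(2) card_2_iff'[of V] card_le_Suc0_iff_eq[OF simple_graph_finite[OF assms(1)]]
    by (auto simp: two_edge_connected_def numeral_2_eq_2)
  then obtain P Q where PQ: "P \<in> V" "Q \<in> V" "P \<noteq> Q"
    by blast
  have "complete_graph V E" if "galois_point V E D P" "galois_point V E D Q" "P \<noteq> Q" for P Q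
    using that unfolding assms(3) by (rule two_galois_points_complete[OF assms(1)])
  \<comment> \<open>The rank is part of \<open>galois_point\<close>, so it can be read off at any
    one vertex.\<close>
  moreover have "div_rank V E D = 2" if "complete_graph V E"
    using all[OF that PQ(1)] by (simp add: galois_point_def)
  ultimately show ?thesis
    using all PQ by metis
qed

end
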